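(* Let $D_4=\{x\in\mathbb{Z}^4 \mid x_1+x_2+x_3+x_4\equiv 0 \pmod 2\}$, let $D_4^*=\{y\in\mathbb{R}^4\mid \langle y,x\rangle\in\mathbb{Z}\ \forall x\in D_4\}$ be its dual, let $D_4'=\sqrt{2}\,D_4^*$, and set $E=D_4\cup D_4'$. For $m>0$ let $E_m=\{x\in E\mid \langle x,x\rangle=m\}$. Then: (i) For every even integer $2m\ge 2$, the shell $E_{2m}$ is a spherical $7$-design on $S^3_{2m}$; in particular $E_2$ is a spherical $7$-design of size $48$ on $S^3_2$. (ii) The set $X=\frac{1}{\sqrt2}E_2\cup\frac{1}{\sqrt6}E_6\subset S^3$ is the support of a cubature formula of strength $11$ on $S^3$ (i.e. there is a weight function $W:X\to\mathbb{R}_{>0}$ such that $(X,W)$ is a cubature formula of strength $11$), and $|X|=240$. (iii) The set $X=\frac{1}{\sqrt2}E_2\cup\frac{1}{\sqrt6}E_6\cup\frac{1}{\sqrt{10}}E_{10}\subset S^3$ is the support of a cubature formula of strength $15$ on $S^3$, and $|X|=528$.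
   Context: For $r>0$, $S^{n-1}_r=\{x\in\mathbb{R}^n\mid \langle x,x\rangle=r\}$ with the canonical scalar product, $S^{n-1}=S^{n-1}_1$, and $\sigma$ is the rotation-invariant probability measure on $S^{n-1}_r$. A cubature formula of strength $t$ on $S^{n-1}_r$ is a pair $(X,W)$ with $X\subset S^{n-1}_r$ finite and $W:X\to\mathbb{R}_{>0}$ such that $\sum_{x\in X}W(x)f(x)=\int_{S^{n-1}_r}f\,d\sigma$ for every polynomial $f:\mathbb{R}^n\to\mathbb{C}$ of degree at most $t$; $X$ is its support and $|X|$ its size. A spherical $t$-design on $S^{n-1}_r$ is a finite $X\subset S^{n-1}_r$ such that $(X,W)$ with constant weight $W\equiv |X|^{-1}$ is a cubature formula of strength $t$. *)

theory Defs
  imports "HOL-Probability.Probability"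
begin

section \<open>Spheres and their rotation-invariant probability measure\<close>

text \<open>The parameter \<open>r\<close> is the square of the radius.\<close>

definition sqsphere :: "real \<Rightarrow> (real^'n) set" where
  "sqsphere r = {x. x \<bullet> x = r}"

text \<open>
  Invariance is required under the full orthogonal group, so that the notion also makes sense for
  \<open>CARD('n) = 1\<close>.
\<close>

definition rotation_invariant_prob :: "real \<Rightarrow> (real^'n) measure \<Rightarrow> bool" where
  "rotation_invariant_prob r M \<longleftrightarrow>
     prob_space M \<and> sets M = sets (restrict_space borel (sqsphere r)) \<and>
     (\<forall>f. orthogonal_transformation f \<longrightarrow> distr M M f = M)"

definition sphere_measure :: "real \<Rightarrow> (real^'n) measure" where
  "sphere_measure r = (THE M. rotation_invariant_prob r M)"


subsection \<open>Existence and uniqueness\<close>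

lemma sqsphere_iff_norm: "r \<ge> 0 \<Longrightarrow> x \<in> sqsphere r \<longleftrightarrow> norm x = sqrt r"
  by (auto simp: sqsphere_def norm_eq_sqrt_inner)

lemma compact_sqsphere: "r \<ge> 0 \<Longrightarrow> compact (sqsphere r :: (real^'n) set)"
proof -
  assume "r \<ge> 0"
  hence "(sqsphere r :: (real^'n) set) = sphere 0 (sqrt r)"
    by (auto simp: sqsphere_iff_norm)
  thus ?thesis by simp
qed

lemma sqsphere_borel: "(sqsphere r :: (real^'n) set) \<in> sets borel"
  unfolding sqsphere_def by measurable

lemma orthogonal_transformation_sqsphere:
  "orthogonal_transformation f \<Longrightarrow> f x \<in> sqsphere r \<longleftrightarrow> x \<in> sqsphere r"
  by (auto simp: sqsphere_def orthogonal_transformation_def)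

lemma orthogonal_transformation_borel:
  fixes f :: "real^'n \<Rightarrow> real^'n"
  shows "orthogonal_transformation f \<Longrightarrow> f \<in> borel_measurable borel"
  by (intro borel_measurable_continuous_onI linear_continuous_on
      linear_conv_bounded_linear[THEN iffD1] orthogonal_transformation_linear)

lemma orthogonal_transformation_measurable:
  fixes f :: "real^'n \<Rightarrow> real^'n"
  assumes "orthogonal_transformation f"
  shows "f \<in> measurable (restrict_space borel (sqsphere r)) (restrict_space borel (sqsphere r))"
  by (rule measurable_restrict_space3[OF orthogonal_transformation_borel[OF assms]])
     (use assms orthogonal_transformation_sqsphere in auto)

context
  fixes r :: real and M :: "(real^'n) measure"
  assumes M: "rotation_invariant_prob r M"
begin

lemma rip_prob: "prob_space M"
  and rip_sets: "sets M = sets (restrict_space borel (sqsphere r))"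
  and rip_distr: "orthogonal_transformation f \<Longrightarrow> distr M M f = M"
  using M by (auto simp: rotation_invariant_prob_def)

lemma rip_space: "space M = sqsphere r"
  using sets_eq_imp_space_eq[OF rip_sets] by (simp add: space_restrict_space)

lemma rip_sets_iff: "A \<in> sets M \<longleftrightarrow> A \<in> sets borel \<and> A \<subseteq> sqsphere r"
  unfolding rip_sets by (subst sets_restrict_space_iff) (auto simp: sqsphere_borel)

lemma rip_ball_eq:
  assumes "x \<in> sqsphere r" "y \<in> sqsphere r"
  shows "emeasure M (ball x d \<inter> sqsphere r) = emeasure M (ball y d \<inter> sqsphere r)"
proof -
  have "norm x = norm y"
    using assms by (auto simp: sqsphere_def norm_eq_sqrt_inner)
  then obtain f where f: "orthogonal_transformation f" "f x = y"
    using orthogonal_transformation_exists by blast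
  have meas: "f \<in> measurable M M"
    using orthogonal_transformation_measurable[OF f(1), of r]
    by (simp add: measurable_cong_sets[OF rip_sets rip_sets])
  have dist: "dist (f u) (f v) = dist u v" for u v
    using linear_diff[OF orthogonal_transformation_linear[OF f(1)], of u v]
      orthogonal_transformation_norm[OF f(1), of "u - v"] by (simp add: dist_norm)
  have "emeasure M (ball y d \<inter> sqsphere r) = emeasure (distr M M f) (ball y d \<inter> sqsphere r)"
    using rip_distr[OF f(1)] by simp
  also have "\<dots> = emeasure M (f -` (ball y d \<inter> sqsphere r) \<inter> space M)"
    by (rule emeasure_distr[OF meas]) (auto simp: rip_sets_iff sqsphere_borel)
  also have "f -` (ball y d \<inter> sqsphere r) \<inter> space M = ball x d \<inter> sqsphere r"
    using orthogonal_transformation_sqsphere[OF f(1)] dist[of x]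
    by (simp add: rip_space set_eq_iff f(2))
  finally show ?thesis by simp
qed

lemma rip_ball_pos:
  assumes "r > 0" "d > 0" "x \<in> sqsphere r"
  shows "emeasure M (ball x d \<inter> sqsphere r) \<noteq> 0"
proof
  assume 0: "emeasure M (ball x d \<inter> sqsphere r) = 0"
  interpret prob_space M by (rule rip_prob)
  have cpt: "compact (sqsphere r :: (real^'n) set)"
    using assms by (intro compact_sqsphere) auto
  have cov: "sqsphere r \<subseteq> (\<Union>y\<in>sqsphere r. ball y d :: (real^'n) set)"
    using assms by auto
  obtain F :: "(real^'n) set" where F: "F \<subseteq> sqsphere r" "finite F" "sqsphere r \<subseteq> (\<Union>y\<in>F. ball y d)"
    by (rule compactE_image[OF cpt _ cov]) auto
  have "ball y d \<inter> sqsphere r \<in> null_sets M" if "y \<in> F" for y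
    using 0 rip_ball_eq[OF assms(3), of y d] F that
    by (auto simp: null_sets_def rip_sets_iff sqsphere_borel)
  hence "(\<Union>y\<in>F. ball y d \<inter> sqsphere r) \<in> null_sets M"
    using F(2) by (intro null_sets_UN' countable_finite) auto
  also have "(\<Union>y\<in>F. ball y d \<inter> sqsphere r) = space M"
    using F by (auto simp: rip_space)
  finally show False using emeasure_space_1 by (auto simp: null_sets_def)
qed

end

text \<open>The comparison argument is due to Christensen.\<close>

lemma rip_compare:
  fixes M N :: "(real^'n) measure"
  assumes M: "rotation_invariant_prob r M" and N: "rotation_invariant_prob r N"
    and r: "r > 0" and a: "a \<in> sqsphere r" and d: "d > 0"
    and V: "open V" and U: "U \<in> sets borel" "\<And>x. x \<in> U \<inter> sqsphere r \<Longrightarrow> ball x d \<inter> sqsphere r \<subseteq> V"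
  shows "emeasure M (U \<inter> sqsphere r) * emeasure N (ball a d \<inter> sqsphere r)
         \<le> emeasure N (V \<inter> sqsphere r) * emeasure M (ball a d \<inter> sqsphere r)"
proof -
  interpret M: prob_space M by (rule rip_prob[OF M])
  interpret N: prob_space N by (rule rip_prob[OF N])
  interpret pair_sigma_finite M N ..
  note sp = rip_space[OF M] rip_space[OF N] and st = rip_sets_iff[OF M] rip_sets_iff[OF N]
  have [measurable]: "(\<lambda>x. x) \<in> borel_measurable M" "(\<lambda>x. x) \<in> borel_measurable N"
    by (simp_all add: measurable_cong_sets[OF rip_sets[OF M] refl]
        measurable_cong_sets[OF rip_sets[OF N] refl] measurable_restrict_space1)
  have [measurable]: "fst \<in> borel_measurable (M \<Otimes>\<^sub>M N)" "snd \<in> borel_measurable (M \<Otimes>\<^sub>M N)"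
    using measurable_compose[OF measurable_fst, of "\<lambda>x. x" M borel N]
      measurable_compose[OF measurable_snd, of "\<lambda>x. x" N borel M] by simp_all
  have [measurable]: "V \<in> sets borel" "U \<in> sets borel" using U(1) V by auto
  define A where "A = {p \<in> space (M \<Otimes>\<^sub>M N). fst p \<in> U \<and> dist (fst p) (snd p) < d}"
  define B where "B = {p \<in> space (M \<Otimes>\<^sub>M N). snd p \<in> V \<and> dist (fst p) (snd p) < d}"
  have A: "A \<in> sets (M \<Otimes>\<^sub>M N)" and B: "B \<in> sets (M \<Otimes>\<^sub>M N)"
    unfolding A_def B_def by measurable
  have "emeasure (M \<Otimes>\<^sub>M N) A = (\<integral>\<^sup>+x. emeasure N (Pair x -` A) \<partial>M)"
    by (rule N.emeasure_pair_measure_alt[OF A])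
  also have "\<dots> = (\<integral>\<^sup>+x. emeasure N (ball a d \<inter> sqsphere r) * indicator (U \<inter> sqsphere r) x \<partial>M)"
  proof (rule nn_integral_cong)
    fix x assume x: "x \<in> space M"
    have "Pair x -` A = (if x \<in> U then ball x d \<inter> sqsphere r else {})"
      using x by (auto simp: A_def space_pair_measure sp)
    thus "emeasure N (Pair x -` A) =
        emeasure N (ball a d \<inter> sqsphere r) * indicator (U \<inter> sqsphere r) x"
      using rip_ball_eq[OF N, of x a d] a x by (auto simp: sp)
  qed
  also have "\<dots> = emeasure N (ball a d \<inter> sqsphere r) * emeasure M (U \<inter> sqsphere r)"
    by (rule nn_integral_cmult_indicator) (auto simp: st sqsphere_borel)
  finally have eA: "emeasure (M \<Otimes>\<^sub>M N) A =
      emeasure N (ball a d \<inter> sqsphere r) * emeasure M (U \<inter> sqsphere r)" .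
  have "emeasure (M \<Otimes>\<^sub>M N) B = (\<integral>\<^sup>+y. emeasure M ((\<lambda>x. (x, y)) -` B) \<partial>N)"
    by (rule emeasure_pair_measure_alt2[OF B])
  also have "\<dots> = (\<integral>\<^sup>+y. emeasure M (ball a d \<inter> sqsphere r) * indicator (V \<inter> sqsphere r) y \<partial>N)"
  proof (rule nn_integral_cong)
    fix y assume y: "y \<in> space N"
    have "(\<lambda>x. (x, y)) -` B = (if y \<in> V then ball y d \<inter> sqsphere r else {})"
      using y by (auto simp: B_def space_pair_measure sp dist_commute)
    thus "emeasure M ((\<lambda>x. (x, y)) -` B) =
        emeasure M (ball a d \<inter> sqsphere r) * indicator (V \<inter> sqsphere r) y"
      using rip_ball_eq[OF M, of y a d] a y by (auto simp: sp)
  qed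
  also have "\<dots> = emeasure M (ball a d \<inter> sqsphere r) * emeasure N (V \<inter> sqsphere r)"
    by (rule nn_integral_cmult_indicator) (auto simp: st sqsphere_borel)
  finally have eB: "emeasure (M \<Otimes>\<^sub>M N) B =
      emeasure M (ball a d \<inter> sqsphere r) * emeasure N (V \<inter> sqsphere r)" .
  have "A \<subseteq> B"
    using U(2) by (fastforce simp: A_def B_def space_pair_measure sp)
  hence "emeasure (M \<Otimes>\<^sub>M N) A \<le> emeasure (M \<Otimes>\<^sub>M N) B"
    by (rule emeasure_mono[OF _ B])
  thus ?thesis unfolding eA eB by (simp add: mult.commute)
qed

lemma rip_open_le:
  fixes M N :: "(real^'n) measure"
  assumes M: "rotation_invariant_prob r M" and N: "rotation_invariant_prob r N"
    and r: "r > 0" and V: "open V"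
  shows "emeasure M (V \<inter> sqsphere r) \<le> emeasure N (V \<inter> sqsphere r)"
proof -
  interpret M: prob_space M by (rule rip_prob[OF M])
  interpret N: prob_space N by (rule rip_prob[OF N])
  obtain a :: "real^'n" where a: "a \<in> sqsphere r"
    using M.not_empty rip_space[OF M] by auto
  define U where "U n = {x \<in> V. ball x (1 / Suc n) \<inter> sqsphere r \<subseteq> V}" for n :: nat
  have "- {x. ball x (1 / Suc n) \<inter> sqsphere r \<subseteq> V} = (\<Union>y\<in>sqsphere r - V. ball y (1 / Suc n))"
    for n by (auto simp: dist_commute)
  hence "closed {x. ball x (1 / Suc n) \<inter> sqsphere r \<subseteq> V}" for n
    unfolding closed_def by (metis open_UN open_ball)
  moreover have "U n = V \<inter> {x. ball x (1 / Suc n) \<inter> sqsphere r \<subseteq> V}" for n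
    by (auto simp: U_def)
  ultimately have Ub: "U n \<in> sets borel" for n
    using V by auto
  have le: "emeasure M (U n \<inter> sqsphere r) \<le> emeasure N (V \<inter> sqsphere r)" for n
  proof -
    let ?b = "ball a (1 / Suc n) \<inter> sqsphere r"
    have eq: "emeasure N ?b = emeasure M ?b"
    proof (rule antisym)
      show "emeasure N ?b \<le> emeasure M ?b"
        using rip_compare[OF M N r a, of "1 / Suc n" UNIV UNIV]
          M.emeasure_space_1 N.emeasure_space_1 rip_space[OF M] rip_space[OF N] by simp
      show "emeasure M ?b \<le> emeasure N ?b"
        using rip_compare[OF N M r a, of "1 / Suc n" UNIV UNIV]
          M.emeasure_space_1 N.emeasure_space_1 rip_space[OF M] rip_space[OF N] by simp
    qed
    have "emeasure M (U n \<inter> sqsphere r) * emeasure N ?b \<le> emeasure N (V \<inter> sqsphere r) * emeasure M ?b"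
      by (rule rip_compare[OF M N r a _ V Ub]) (auto simp: U_def)
    moreover have "emeasure M ?b \<noteq> 0" "emeasure M ?b \<noteq> \<infinity>"
      using rip_ball_pos[OF M r _ a, of "1 / Suc n"] by simp_all
    ultimately show ?thesis
      unfolding eq mult.commute[of _ "emeasure M ?b"] infinity_ennreal_def
      using ennreal_mult_le_mult_iff[of "emeasure M ?b"] by blast
  qed
  have "incseq (\<lambda>n. U n \<inter> sqsphere r)"
  proof (rule incseq_SucI)
    fix n
    have "1 / real (Suc (Suc n)) \<le> 1 / real (Suc n)"
      by (simp add: field_simps)
    hence "ball x (1 / real (Suc (Suc n))) \<subseteq> ball x (1 / real (Suc n))" for x :: "real^'n"
      by (rule subset_ball)
    thus "U n \<inter> sqsphere r \<subseteq> U (Suc n) \<inter> sqsphere r"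
      unfolding U_def by blast
  qed
  moreover have "range (\<lambda>n. U n \<inter> sqsphere r) \<subseteq> sets M"
    using sets.Int[OF Ub sqsphere_borel] by (auto simp: rip_sets_iff[OF M])
  ultimately have "(SUP n. emeasure M (U n \<inter> sqsphere r)) = emeasure M (\<Union>n. U n \<inter> sqsphere r)"
    by (intro SUP_emeasure_incseq)
  also have "(\<Union>n. U n \<inter> sqsphere r) = V \<inter> sqsphere r"
  proof -
    have "\<exists>n. x \<in> U n" if x: "x \<in> V" for x
    proof -
      obtain e where e: "e > 0" "ball x e \<subseteq> V" using V x openE by blast
      obtain n where "1 / Suc n < e" using nat_approx_posE[OF e(1)] by blast
      thus ?thesis using e x by (intro exI[of _ n]) (auto simp: U_def)
    qed
    thus ?thesis by (auto simp: U_def)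
  qed
  finally show ?thesis using le by (metis SUP_least)
qed

lemma rotation_invariant_prob_unique:
  fixes M N :: "(real^'n) measure"
  assumes M: "rotation_invariant_prob r M" and N: "rotation_invariant_prob r N" and r: "r > 0"
  shows "M = N"
proof -
  interpret M: prob_space M by (rule rip_prob[OF M])
  have id: "(\<lambda>x. x) \<in> borel_measurable M" "(\<lambda>x. x) \<in> borel_measurable N"
    by (simp_all add: measurable_cong_sets[OF rip_sets[OF M] refl]
        measurable_cong_sets[OF rip_sets[OF N] refl] measurable_restrict_space1)
  have emM: "emeasure (distr M borel (\<lambda>x. x)) A = emeasure M (A \<inter> sqsphere r)"
    and emN: "emeasure (distr N borel (\<lambda>x. x)) A = emeasure N (A \<inter> sqsphere r)"
    if "A \<in> sets borel" for A
    using that by (simp_all add: emeasure_distr id rip_space[OF M] rip_space[OF N])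
  have eq: "distr M borel (\<lambda>x. x) = distr N borel (\<lambda>x. x)"
  proof (rule measure_eqI_generator_eq[where E = "{S. open S}" and \<Omega> = UNIV and A = "\<lambda>_. UNIV"])
    show "Int_stable {S :: (real^'n) set. open S}" by (auto simp: Int_stable_def)
    show "emeasure (distr M borel (\<lambda>x. x)) V = emeasure (distr N borel (\<lambda>x. x)) V"
      if "V \<in> {S. open S}" for V
      using that rip_open_le[OF M N r, of V] rip_open_le[OF N M r, of V]
      by (simp add: emM emN)
      show "emeasure (distr M borel (\<lambda>x. x)) UNIV \<noteq> \<infinity>" by (simp add: emM)
  qed (auto simp: borel_def)
  show ?thesis
  proof (rule measure_eqI)
    show "sets M = sets N" by (simp add: rip_sets[OF M] rip_sets[OF N])
    fix A assume "A \<in> sets M"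
    hence "A \<in> sets borel" "A \<inter> sqsphere r = A"
      using rip_sets_iff[OF M] by auto
    thus "emeasure M A = emeasure N A" using emM emN eq by metis
  qed
qed

text \<open>
  The class \<open>wellorder\<close> is inherited from \<open>measure_orthogonal_image\<close>; all numeral types belong to it.
\<close>

lemma rotation_invariant_prob_exists:
  assumes r: "r > 0"
  shows "\<exists>M :: (real^'n::{finite,wellorder}) measure. rotation_invariant_prob r M"
proof -
  let ?S = "sqsphere r :: (real^'n::_) set"
  let ?D = "ball 0 1 - {0} :: (real^'n::_) set"
  define e :: "real^'n::_" where "e = sqrt r *\<^sub>R axis undefined 1"
  define g :: "real^'n::_ \<Rightarrow> real^'n::_" where
    "g x = (if x = 0 then e else (sqrt r / norm x) *\<^sub>R x)" for x
  define P :: "(real^'n::_) measure" where "P = uniform_measure lborel ?D"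
  let ?R = "restrict_space borel ?S"
  have gS: "g x \<in> ?S" for x
    using r by (auto simp: g_def e_def sqsphere_def dot_square_norm power2_eq_square)
  have gb: "g \<in> borel_measurable borel"
    unfolding g_def by measurable
  have gm: "g \<in> measurable P ?R"
    using gb gS by (auto simp: P_def intro!: measurable_restrict_space2)
  have D: "?D \<in> sets lborel" by auto
  have eD: "emeasure lborel ?D = emeasure lborel (ball 0 1 :: (real^'n::_) set)"
    by (rule emeasure_Diff_null_set) auto
  have Dfin: "emeasure lborel ?D \<noteq> \<infinity>"
    using emeasure_bounded_finite[of ?D] bounded_subset[OF bounded_ball, of ?D 0 1] by auto
  have Dpos: "emeasure lborel ?D \<noteq> 0"
    unfolding eD using open_not_negligible[of "ball 0 1 :: (real^'n::_) set"]
    by (auto simp: negligible_iff_null_sets null_sets_def emeasure_lborel_countable)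
  interpret P: prob_space P
    unfolding P_def by (rule prob_space_uniform_measure[OF Dpos Dfin])
  define M where "M = distr P ?R g"
  have emM: "emeasure M A = emeasure lborel (?D \<inter> g -` A) / emeasure lborel ?D"
    if A: "A \<in> sets borel" "A \<subseteq> ?S" for A
  proof -
    have "g -` A \<in> sets borel"
      using measurable_sets[OF gb A(1)] by simp
    moreover have "A \<in> sets ?R"
      using A by (subst sets_restrict_space_iff) (auto simp: sqsphere_borel)
    ultimately show ?thesis
      using A gm D unfolding M_def by (subst emeasure_distr) (auto simp: P_def)
  qed
  have leb: "emeasure lebesgue B = emeasure lborel B"
    if "B \<in> sets borel" for B :: "(real^'n::_) set"
    using that by simp
  have spM: "space M = ?S" by (simp add: M_def space_restrict_space)
  have "rotation_invariant_prob r M"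
    unfolding rotation_invariant_prob_def
  proof (intro conjI allI impI)
    show "prob_space M" unfolding M_def by (rule P.prob_space_distr[OF gm])
    show setsM: "sets M = sets ?R" by (simp add: M_def)
    fix f :: "real^'n::_ \<Rightarrow> real^'n::_" assume f: "orthogonal_transformation f"
    have fm: "f \<in> measurable M M"
      using orthogonal_transformation_measurable[OF f, of r]
      by (simp add: measurable_cong_sets[OF setsM setsM])
    show "distr M M f = M"
    proof (rule measure_eqI)
      fix A assume "A \<in> sets (distr M M f)"
      hence "A \<in> sets ?R" using setsM by simp
      hence A: "A \<in> sets borel" "A \<subseteq> ?S"
        by (simp_all add: sets_restrict_space_iff sqsphere_borel)
      have fA: "f -` A \<in> sets borel"
        using measurable_sets[OF orthogonal_transformation_borel[OF f] A(1)] by simp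
      have fAS: "f -` A \<subseteq> ?S" using A(2) orthogonal_transformation_sqsphere[OF f] by blast
      have bij: "bij f" by (rule orthogonal_transformation_bij[OF f])
      have nf: "norm (f x) = norm x" for x
        by (rule orthogonal_transformation_norm[OF f])
      have f0: "f x = 0 \<longleftrightarrow> x = 0" for x
        using nf[of x] by (metis norm_eq_zero)
      have fD: "f x \<in> ?D \<longleftrightarrow> x \<in> ?D" for x
        by (simp add: nf f0)
      have fg: "f (g x) = g (f x)" if "x \<in> ?D" for x
        using that orthogonal_transformation_scaleR[OF f] by (simp add: g_def nf f0)
      have img: "f ` (?D \<inter> g -` (f -` A)) = ?D \<inter> g -` A"
      proof (intro equalityI subsetI)
        fix y assume y: "y \<in> ?D \<inter> g -` A"
        obtain x where x: "y = f x" using bij bij_is_surj by (metis surjD)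
        have "x \<in> ?D" using y fD[of x] x by simp
        moreover have "x \<in> g -` (f -` A)" using y fg[OF \<open>x \<in> ?D\<close>] x by simp
        ultimately show "y \<in> f ` (?D \<inter> g -` (f -` A))" unfolding x by blast
      next
        fix y assume "y \<in> f ` (?D \<inter> g -` (f -` A))"
        then obtain x where x: "y = f x" "x \<in> ?D" "f (g x) \<in> A" by blast
        thus "y \<in> ?D \<inter> g -` A" using fD[of x] fg[OF x(2)] by simp
      qed
      have lm: "?D \<inter> g -` B \<in> lmeasurable" "?D \<inter> g -` B \<in> sets borel" if "B \<in> sets borel" for B
      proof -
        show 1: "?D \<inter> g -` B \<in> sets borel"
          using measurable_sets[OF gb that] by auto
        show "?D \<inter> g -` B \<in> lmeasurable"
          by (rule bounded_set_imp_lmeasurable)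
             (use 1 in \<open>auto intro: bounded_subset[OF bounded_ball]\<close>)
      qed
      have "measure lebesgue (?D \<inter> g -` A) = measure lebesgue (?D \<inter> g -` (f -` A))"
        using measure_orthogonal_image[OF f lm(1)[OF fA]] img by simp
      hence "emeasure lebesgue (?D \<inter> g -` A) = emeasure lebesgue (?D \<inter> g -` (f -` A))"
        using emeasure_eq_measure2[OF lm(1)[OF A(1)]] emeasure_eq_measure2[OF lm(1)[OF fA]]
        by (simp only:)
      hence "emeasure lborel (?D \<inter> g -` A) = emeasure lborel (?D \<inter> g -` (f -` A))"
        by (simp only: leb[OF lm(2)[OF A(1)]] leb[OF lm(2)[OF fA]])
      hence "emeasure M A = emeasure M (f -` A)"
        by (simp only: emM[OF A] emM[OF fA fAS])
      also have "\<dots> = emeasure (distr M M f) A"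
        using \<open>A \<in> sets ?R\<close> setsM fAS by (subst emeasure_distr[OF fm]) (auto simp: spM Int_absorb2)
      finally show "emeasure (distr M M f) A = emeasure M A" by simp
    qed simp
  qed
  thus ?thesis by blast
qed

theorem rotation_invariant_prob_sphere_measure:
  assumes "r > 0"
  shows "rotation_invariant_prob r (sphere_measure r :: (real^'n::{finite,wellorder}) measure)"
proof -
  obtain M :: "(real^'n::_) measure" where M: "rotation_invariant_prob r M"
    using rotation_invariant_prob_exists[OF assms] by (rule exE)
  show ?thesis
    unfolding sphere_measure_def
    by (rule theI[of _ M]) (rule M, rule rotation_invariant_prob_unique[OF _ M assms])
qed


section \<open>Cubature formulas and spherical designs\<close>

definition poly_fun_deg_le :: "nat \<Rightarrow> (real^'n \<Rightarrow> complex) \<Rightarrow> bool" where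
  "poly_fun_deg_le t f \<longleftrightarrow>
     (\<exists>c :: ('n \<Rightarrow> nat) \<Rightarrow> complex.
        f = (\<lambda>x. \<Sum>\<alpha> | (\<Sum>i\<in>UNIV. \<alpha> i) \<le> t. c \<alpha> * complex_of_real (\<Prod>i\<in>UNIV. (x $ i) ^ \<alpha> i)))"

text \<open>The index set of the sum is finite, so the sum is not the default value \<open>0\<close>.\<close>

lemma finite_exponents: "finite {\<alpha> :: 'n::finite \<Rightarrow> nat. (\<Sum>i\<in>UNIV. \<alpha> i) \<le> t}"
proof (rule finite_subset)
  show "{\<alpha> :: 'n \<Rightarrow> nat. (\<Sum>i\<in>UNIV. \<alpha> i) \<le> t} \<subseteq> (UNIV \<rightarrow>\<^sub>E {..t})"
  proof
    fix \<alpha> :: "'n \<Rightarrow> nat" assume "\<alpha> \<in> {\<alpha>. (\<Sum>i\<in>UNIV. \<alpha> i) \<le> t}"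
    hence "\<alpha> i \<le> t" for i
      using member_le_sum[of i UNIV \<alpha>] by simp
    thus "\<alpha> \<in> UNIV \<rightarrow>\<^sub>E {..t}" by auto
  qed
  show "finite ((UNIV :: 'n set) \<rightarrow>\<^sub>E {..t})"
    by (rule finite_PiE) simp_all
qed

definition cubature_formula ::
    "nat \<Rightarrow> real \<Rightarrow> (real^'n) set \<Rightarrow> (real^'n \<Rightarrow> real) \<Rightarrow> bool" where
  "cubature_formula t r X W \<longleftrightarrow>
     finite X \<and> X \<subseteq> sqsphere r \<and> (\<forall>x\<in>X. W x > 0) \<and>
     (\<forall>f. poly_fun_deg_le t f \<longrightarrow>
        (\<Sum>x\<in>X. complex_of_real (W x) * f x) = (\<integral>x. f x \<partial>sphere_measure r))"

definition spherical_design :: "nat \<Rightarrow> real \<Rightarrow> (real^'n) set \<Rightarrow> bool" where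
  "spherical_design t r X \<longleftrightarrow> cubature_formula t r X (\<lambda>_. 1 / real (card X))"


section \<open>The set \<open>E\<close>\<close>

definition D4 :: "(real^4) set" where
  "D4 = {x. \<exists>z :: 4 \<Rightarrow> int. x = (\<chi> i. real_of_int (z i)) \<and> (\<Sum>i\<in>UNIV. z i) mod 2 = 0}"

definition dual_lattice :: "(real^'n) set \<Rightarrow> (real^'n) set" where
  "dual_lattice L = {y. \<forall>x\<in>L. y \<bullet> x \<in> \<int>}"

definition D4' :: "(real^4) set" where
  "D4' = (\<lambda>x. sqrt 2 *\<^sub>R x) ` dual_lattice D4"

definition D4_union :: "(real^4) set" where
  "D4_union = D4 \<union> D4'"

definition shell :: "real \<Rightarrow> (real^4) set" where
  "shell m = {x \<in> D4_union. x \<bullet> x = m}"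

end

theory Submission
  imports Defs "HOL-Number_Theory.Cong"
begin

text \<open>
  Rotation invariance in coordinate planes makes the even moments of a fixed degree \<open>2 k\<close> of the sphere
  proportional to products of double factorials. Homogenizing with \<open>x \<bullet> x = r\<close>, a finite weighted set
  symmetric under sign changes is therefore a cubature formula of strength \<open>2 k + 1\<close> as soon as its
  moments of degree \<open>2 k\<close> have the same ratios. The set \<open>E\<close> is invariant under signed permutations and
  under an orthogonal involution exchanging \<open>D\<^sub>4\<close> and \<open>D\<^sub>4'\<close>; these symmetries alone force the right
  ratios in degree 6. In degrees 10 and 14 the ratios are a finite computation over the integer
  vectors of norm 2, 6 and 10. Lagrange's four square theorem shows that no even shell is empty.
\<close>

section \<open>Moments of the sphere\<close>

text \<open>No moment of the sphere is ever evaluated. Rotations give the ratios within one even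
  degree, and the unknown factor drops out because the sphere and the weighted set both have total
  mass 1 in degree 0. On the side of the points, \<open>tau\<close> carries \<open>D4\<close> onto
  \<open>D4'\<close>, so each even shell consists of the integer vectors of that norm and their
  images under \<open>tau\<close>. Only even powers of the coordinates survive the sign changes,
  hence the factor \<open>sqrt 2\<close> in \<open>tau\<close> contributes only powers of 2 and the
  top moments become integer sums. In degree 6 there are three moments up to permutation, and
  \<open>tau\<close> supplies two linear relations between them. In degree 10 the norm 2 shell alone
  already has wrong ratios, so several radii must be combined. Shrinking a shell of norm
  \<open>m\<close> to the unit sphere divides its moments of degree \<open>2 * k\<close> by
  \<open>m ^ k\<close>; a weight proportional to \<open>m ^ k\<close> undoes this, so the numerical
  check can use the unscaled shells. The sizes 240 and 528 rest on irrationality: the parity of a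
  prime valuation separates \<open>D4\<close> from \<open>D4'\<close> and the unit shells from each
  other.\<close>

definition monomial :: "('n::finite \<Rightarrow> nat) \<Rightarrow> real^'n \<Rightarrow> real" where
  "monomial \<alpha> x = (\<Prod>i\<in>UNIV. (x $ i) ^ \<alpha> i)"

text \<open>The double factorial \<open>(2 l - 1)!!\<close>.\<close>

definition odd_fact :: "nat \<Rightarrow> real" where
  "odd_fact l = fact (2 * l) / (2 ^ l * fact l)"

definition plane_rotation :: "'n::finite \<Rightarrow> 'n \<Rightarrow> real \<Rightarrow> real \<Rightarrow> real^'n \<Rightarrow> real^'n" where
  "plane_rotation i j c s x =
     (\<chi> k. if k = i then c * x $ i + s * x $ j else if k = j then c * x $ j - s * x $ i else x $ k)"

definition coord_flip :: "'n::finite \<Rightarrow> real^'n \<Rightarrow> real^'n" where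
  "coord_flip i x = (\<chi> k. if k = i then - x $ k else x $ k)"

lemma odd_fact_pos: "odd_fact l > 0"
  by (simp add: odd_fact_def)

lemma odd_fact_0 [simp]: "odd_fact 0 = 1"
  by (simp add: odd_fact_def)

lemma odd_fact_Suc: "odd_fact (Suc l) = (2 * real l + 1) * odd_fact l"
proof -
  have "fact (2 * Suc l) = (2 * real l + 2) * ((2 * real l + 1) * fact (2 * l))"
    by (simp add: algebra_simps)
  moreover have "2 ^ Suc l * fact (Suc l) = (2 * real l + 2) * (2 ^ l * fact l)"
    by (simp add: algebra_simps)
  moreover have "2 * real l + 2 \<noteq> 0" by simp
  ultimately show ?thesis
    unfolding odd_fact_def by (metis mult_divide_mult_cancel_left times_divide_eq_right)
qed

text \<open>Both sides equal (2N)! / (2^N l! (N-l)!). This converts the quotient of binomial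
  coefficients produced by a plane rotation into double factorials.\<close>

lemma odd_fact_choose:
  assumes "l \<le> N"
  shows "real ((2 * N) choose (2 * l)) * odd_fact l * odd_fact (N - l)
    = real (N choose l) * odd_fact N"
proof -
  have e: "2 * N - 2 * l = 2 * (N - l)" by simp
  have "(2::real) ^ N = 2 ^ l * 2 ^ (N - l)" using assms by (simp flip: power_add)
  thus ?thesis
    using assms by (simp add: odd_fact_def binomial_fact e field_simps diff_mult_distrib)
qed

lemma sum_UNIV_two:
  fixes f :: "'n::finite \<Rightarrow> 'a::comm_monoid_add"
  assumes "i \<noteq> j"
  shows "sum f UNIV = f i + (f j + sum f (UNIV - {i, j}))"
proof -
  have "sum f UNIV = f i + sum f (UNIV - {i})" by (rule sum.remove) auto
  also have "sum f (UNIV - {i}) = f j + sum f (UNIV - {i} - {j})"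
    using assms by (intro sum.remove) auto
  finally show ?thesis by (simp add: Diff_insert2[symmetric] Diff_insert[symmetric] insert_commute)
qed

lemma prod_UNIV_two:
  fixes f :: "'n::finite \<Rightarrow> 'a::comm_monoid_mult"
  assumes "i \<noteq> j"
  shows "prod f UNIV = f i * (f j * prod f (UNIV - {i, j}))"
proof -
  have "prod f UNIV = f i * prod f (UNIV - {i})" by (rule prod.remove) auto
  also have "prod f (UNIV - {i}) = f j * prod f (UNIV - {i} - {j})"
    using assms by (intro prod.remove) auto
  finally show ?thesis by (simp add: Diff_insert2[symmetric] Diff_insert[symmetric] insert_commute)
qed

lemma orthogonal_transformation_plane_rotation:
  assumes "i \<noteq> j" "c\<^sup>2 + s\<^sup>2 = 1"
  shows "orthogonal_transformation (plane_rotation i j c s)"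
  unfolding orthogonal_transformation_def
proof (intro conjI allI)
  show "linear (plane_rotation i j c s)"
    by (rule linearI) (auto simp: plane_rotation_def vec_eq_iff algebra_simps)
  fix v w :: "real^'a"
  let ?R = "plane_rotation i j c s"
  have rest: "(\<Sum>k\<in>UNIV - {i, j}. ?R v $ k * ?R w $ k) = (\<Sum>k\<in>UNIV - {i, j}. v $ k * w $ k)"
    by (rule sum.cong) (auto simp: plane_rotation_def)
  have "?R v $ i * ?R w $ i + ?R v $ j * ?R w $ j = (c\<^sup>2 + s\<^sup>2) * (v $ i * w $ i + v $ j * w $ j)"
    using assms(1) by (simp add: plane_rotation_def algebra_simps power2_eq_square)
  thus "?R v \<bullet> ?R w = v \<bullet> w"
    using rest assms by (simp add: inner_vec_def sum_UNIV_two[OF assms(1)])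
qed

lemma coord_flip_coord_flip [simp]: "coord_flip i (coord_flip i x) = x"
  by (auto simp: coord_flip_def vec_eq_iff)

lemma inner_coord_flip: "coord_flip i x \<bullet> coord_flip i y = x \<bullet> y"
  unfolding inner_vec_def by (rule sum.cong) (auto simp: coord_flip_def)

lemma linear_coord_flip: "linear (coord_flip i)"
  by (rule linearI) (auto simp: coord_flip_def vec_eq_iff)

lemma orthogonal_transformation_coord_flip: "orthogonal_transformation (coord_flip i)"
  by (simp add: orthogonal_transformation_def inner_coord_flip linear_coord_flip)

lemma monomial_coord_flip: "monomial \<alpha> (coord_flip i x) = (-1) ^ \<alpha> i * monomial \<alpha> x"
proof -
  have "monomial \<alpha> (coord_flip i x)
      = (coord_flip i x $ i) ^ \<alpha> i * (\<Prod>k\<in>UNIV - {i}. (coord_flip i x $ k) ^ \<alpha> k)"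
    unfolding monomial_def by (rule prod.remove) auto
  also have "(\<Prod>k\<in>UNIV - {i}. (coord_flip i x $ k) ^ \<alpha> k) = (\<Prod>k\<in>UNIV - {i}. (x $ k) ^ \<alpha> k)"
    by (rule prod.cong) (auto simp: coord_flip_def)
  also have "coord_flip i x $ i = - x $ i" by (simp add: coord_flip_def)
  also have "(- x $ i) ^ \<alpha> i = (-1) ^ \<alpha> i * (x $ i) ^ \<alpha> i" by (rule power_minus)
  also have "(-1) ^ \<alpha> i * (x $ i) ^ \<alpha> i * (\<Prod>k\<in>UNIV - {i}. (x $ k) ^ \<alpha> k)
      = (-1) ^ \<alpha> i * monomial \<alpha> x"
    by (simp add: monomial_def prod.remove[of UNIV i])
  finally show ?thesis .
qed

lemma monomial_update2:
  assumes "i \<noteq> j"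
  shows "monomial (\<gamma>(i := a, j := b)) x = (x $ i) ^ a * (x $ j) ^ b * (\<Prod>k\<in>UNIV - {i, j}. (x $ k) ^ \<gamma> k)"
proof -
  have "(\<Prod>k\<in>UNIV - {i, j}. (x $ k) ^ (\<gamma>(i := a, j := b)) k) = (\<Prod>k\<in>UNIV - {i, j}. (x $ k) ^ \<gamma> k)"
    by (rule prod.cong) auto
  thus ?thesis using assms by (simp add: monomial_def prod_UNIV_two[OF assms])
qed

lemma monomial_borel [measurable]: "monomial \<alpha> \<in> borel_measurable borel"
  unfolding monomial_def[abs_def]
  by (intro borel_measurable_continuous_onI continuous_intros)

section \<open>Integrals of monomials against an invariant measure\<close>

context
  fixes r :: real and M :: "(real^'n) measure"
  assumes r: "r > 0" and M: "rotation_invariant_prob r M"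
begin

lemma borel_measurable_rip: "f \<in> borel_measurable borel \<Longrightarrow> f \<in> borel_measurable M"
  by (simp add: measurable_cong_sets[OF rip_sets[OF M] refl] measurable_restrict_space1)

lemma integrable_monomial: "integrable M (monomial \<alpha>)"
proof -
  interpret prob_space M by (rule rip_prob[OF M])
  have "compact (monomial \<alpha> ` (sqsphere r :: (real^'n) set))"
    unfolding monomial_def[abs_def] using r
    by (intro compact_continuous_image compact_sqsphere continuous_intros) auto
  then obtain B where B: "\<And>x. x \<in> sqsphere r \<Longrightarrow> \<bar>monomial \<alpha> (x :: real^'n)\<bar> \<le> B"
    by (metis compact_imp_bounded bounded_iff imageI real_norm_def)
  show ?thesis
    by (rule integrable_const_bound[where B = B])
       (auto intro!: AE_I2 B borel_measurable_rip simp: rip_space[OF M])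
qed

lemma integral_orthogonal:
  fixes g :: "real^'n \<Rightarrow> real"
  assumes "orthogonal_transformation f" "g \<in> borel_measurable borel"
  shows "(\<integral>x. g (f x) \<partial>M) = (\<integral>x. g x \<partial>M)"
proof -
  have "f \<in> measurable M M"
    using orthogonal_transformation_measurable[OF assms(1), of r]
    by (simp add: measurable_cong_sets[OF rip_sets[OF M] rip_sets[OF M]])
  hence "(\<integral>x. g x \<partial>distr M M f) = (\<integral>x. g (f x) \<partial>M)"
    by (rule integral_distr) (rule borel_measurable_rip[OF assms(2)])
  thus ?thesis by (simp add: rip_distr[OF M assms(1)])
qed

lemma integral_monomial_odd:
  assumes "odd (\<alpha> i)"
  shows "(\<integral>x. monomial \<alpha> x \<partial>M) = 0"
  using integral_orthogonal[OF orthogonal_transformation_coord_flip[of i] monomial_borel[of \<alpha>]] assms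
  by (simp add: monomial_coord_flip)

text \<open>
  Rotate \<open>x\<^sub>i\<close> by the angle with tangent \<open>t\<close> inside the integral of \<open>x\<^sub>i ^ (2 N)\<close> and compare the
  coefficients of \<open>t ^ (2 l)\<close>.
\<close>

lemma integral_monomial_pair:
  assumes ij: "i \<noteq> j" and l: "l \<le> N"
  shows "real ((2 * N) choose (2 * l)) * (\<integral>x. monomial (\<gamma>(i := 2 * N - 2 * l, j := 2 * l)) x \<partial>M)
    = real (N choose l) * (\<integral>x. monomial (\<gamma>(i := 2 * N, j := 0)) x \<partial>M)"
proof -
  define I where "I k = (\<integral>x. monomial (\<gamma>(i := 2 * N - k, j := k)) x \<partial>M)" for k
  define a where "a k = real ((2 * N) choose k) * I k" for k
  \<comment> \<open>These are the coefficients of \<open>I 0 * (1 + t\<^sup>2) ^ N\<close>. The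
    cosine enters the expansion only as \<open>c ^ (2 * N)\<close>, which is the inverse of
    \<open>(1 + t\<^sup>2) ^ N\<close>, so clearing it leaves an identity of polynomials in
    \<open>t\<close>.\<close>
  define b where "b k = (if even k then real (N choose (k div 2)) * I 0 else 0)" for k
  have "(\<Sum>k\<le>2*N. a k * t ^ k) = (\<Sum>k\<le>2*N. b k * t ^ k)" for t :: real
  proof -
    define c where "c = 1 / sqrt (1 + t\<^sup>2)"
    have pos: "1 + t\<^sup>2 > 0" by (simp add: add_pos_nonneg)
    have c2: "c\<^sup>2 = 1 / (1 + t\<^sup>2)"
      using pos by (simp add: c_def power_divide)
    have "c\<^sup>2 + (t * c)\<^sup>2 = 1"
      using pos by (simp add: power_mult_distrib c2 field_simps)
    note R = orthogonal_transformation_plane_rotation[OF ij this]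
    let ?R = "plane_rotation i j c (t * c)"
    have "I 0 = (\<integral>x. monomial (\<gamma>(i := 2 * N, j := 0)) (?R x) \<partial>M)"
      unfolding I_def using integral_orthogonal[OF R monomial_borel] by simp
    also have "\<dots> = (\<integral>x. (\<Sum>k\<le>2*N. (c ^ (2 * N) * real ((2 * N) choose k) * t ^ k) *
        monomial (\<gamma>(i := 2 * N - k, j := k)) x) \<partial>M)"
    proof (rule Bochner_Integration.integral_cong[OF refl])
      fix x :: "real^'n"
      let ?P = "\<Prod>k\<in>UNIV - {i, j}. (x $ k) ^ \<gamma> k"
      have "(\<Prod>k\<in>UNIV - {i, j}. (?R x $ k) ^ \<gamma> k) = ?P"
        by (rule prod.cong) (auto simp: plane_rotation_def)
      hence "monomial (\<gamma>(i := 2 * N, j := 0)) (?R x) = (t * c * x $ j + c * x $ i) ^ (2 * N) * ?P"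
        by (simp add: monomial_update2[OF ij] plane_rotation_def add.commute)
      also have "\<dots> = (\<Sum>k\<le>2*N. real ((2 * N) choose k) * (t * c * x $ j) ^ k * (c * x $ i) ^ (2 * N - k) * ?P)"
        by (simp add: binomial_ring sum_distrib_right)
      also have "\<dots> = (\<Sum>k\<le>2*N. (c ^ (2 * N) * real ((2 * N) choose k) * t ^ k) *
          monomial (\<gamma>(i := 2 * N - k, j := k)) x)"
      proof (rule sum.cong[OF refl])
        fix k assume "k \<in> {..2 * N}"
        hence "c ^ (2 * N) = c ^ k * c ^ (2 * N - k)"
          by (simp flip: power_add)
        thus "real ((2 * N) choose k) * (t * c * x $ j) ^ k * (c * x $ i) ^ (2 * N - k) * ?P
           = (c ^ (2 * N) * real ((2 * N) choose k) * t ^ k) * monomial (\<gamma>(i := 2 * N - k, j := k)) x"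
          by (simp add: monomial_update2[OF ij] power_mult_distrib)
      qed
      finally show "monomial (\<gamma>(i := 2 * N, j := 0)) (?R x) = \<dots>" .
    qed
    also have "\<dots> = (\<Sum>k\<le>2*N. c ^ (2 * N) * real ((2 * N) choose k) * t ^ k * I k)"
      by (simp add: I_def integrable_monomial)
    also have "\<dots> = c ^ (2 * N) * (\<Sum>k\<le>2*N. a k * t ^ k)"
      by (simp add: sum_distrib_left a_def mult_ac)
    also have "c ^ (2 * N) = 1 / (1 + t\<^sup>2) ^ N"
      by (simp add: power_mult c2 power_divide)
    finally have "(\<Sum>k\<le>2*N. a k * t ^ k) = I 0 * (t\<^sup>2 + 1) ^ N"
      using pos by (simp add: field_simps)
    also have "\<dots> = (\<Sum>l\<le>N. b (2 * l) * t ^ (2 * l))"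
      by (simp add: binomial_ring[of "t\<^sup>2"] sum_distrib_left b_def mult_ac flip: power_mult)
    also have "\<dots> = (\<Sum>k\<in>(*) 2 ` {..N}. b k * t ^ k)"
      by (subst sum.reindex) (auto simp: inj_on_def)
    also have "\<dots> = (\<Sum>k\<le>2*N. b k * t ^ k)"
    proof (rule sum.mono_neutral_left)
      show "\<forall>k\<in>{..2*N} - (*) 2 ` {..N}. b k * t ^ k = 0"
        by (auto simp: b_def elim!: evenE)
    qed auto
    finally show ?thesis .
  qed
  hence "\<forall>k\<le>2*N. a k = b k"
    by (subst polyfun_eq_coeffs[symmetric]) blast
  hence "a (2 * l) = b (2 * l)" using l by simp
  thus ?thesis by (simp add: a_def b_def I_def)
qed

text \<open>The plane relation with N = \<beta> i + \<beta> j and l = \<beta> j moves the whole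
  exponent of coordinate j onto coordinate i. Written with products on both sides, it needs no
  division.\<close>

lemma integral_monomial_merge:
  assumes ij: "i \<noteq> j"
  shows "(\<integral>x. monomial (\<lambda>k. 2 * \<beta> k) x \<partial>M) * odd_fact (\<beta> i + \<beta> j)
    = (\<integral>x. monomial (\<lambda>k. 2 * (\<beta>(i := \<beta> i + \<beta> j, j := 0)) k) x \<partial>M) * (odd_fact (\<beta> i) * odd_fact (\<beta> j))"
proof -
  define N where "N = \<beta> i + \<beta> j"
  have 1: "(\<lambda>k. 2 * \<beta> k) = (\<lambda>k. 2 * \<beta> k)(i := 2 * N - 2 * \<beta> j, j := 2 * \<beta> j)"
    by (auto simp: N_def)
  have 2: "(\<lambda>k. 2 * (\<beta>(i := \<beta> i + \<beta> j, j := 0)) k) = (\<lambda>k. 2 * \<beta> k)(i := 2 * N, j := 0)"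
    by (auto simp: N_def)
  let ?A = "\<integral>x. monomial (\<lambda>k. 2 * \<beta> k) x \<partial>M"
  let ?B = "\<integral>x. monomial (\<lambda>k. 2 * (\<beta>(i := \<beta> i + \<beta> j, j := 0)) k) x \<partial>M"
  let ?C = "real ((2 * N) choose (2 * \<beta> j))" and ?c = "real (N choose \<beta> j)"
  have le: "\<beta> j \<le> N" and Nj: "N - \<beta> j = \<beta> i" by (simp_all add: N_def)
  have e: "?C * ?A = ?c * ?B"
    using integral_monomial_pair[OF ij le, of "\<lambda>k. 2 * \<beta> k"] unfolding 1[symmetric] 2[symmetric] .
  have f: "?C * odd_fact (\<beta> j) * odd_fact (\<beta> i) = ?c * odd_fact N"
    using odd_fact_choose[OF le] by (simp add: Nj)
  have "?c * (?A * odd_fact N) = ?A * (?C * odd_fact (\<beta> j) * odd_fact (\<beta> i))"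
    unfolding f by (simp add: mult_ac)
  also have "\<dots> = ?C * ?A * (odd_fact (\<beta> j) * odd_fact (\<beta> i))" by (simp add: mult_ac)
  also have "\<dots> = ?c * (?B * (odd_fact (\<beta> i) * odd_fact (\<beta> j)))" unfolding e by (simp add: mult_ac)
  finally have "?c * (?A * odd_fact N) = ?c * (?B * (odd_fact (\<beta> i) * odd_fact (\<beta> j)))" .
  moreover have "?c \<noteq> 0" using le by simp
  ultimately have "?A * odd_fact N = ?B * (odd_fact (\<beta> i) * odd_fact (\<beta> j))"
    using mult_left_cancel by blast
  thus ?thesis by (simp add: N_def)
qed

text \<open>Merging exponents into one arbitrary coordinate \<open>i0\<close> ends at a pure power
  of that coordinate, which fixes \<kappa>. The induction runs on the number of other coordinates
  that still carry a nonzero exponent.\<close>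

lemma integral_monomial_even:
  "\<exists>\<kappa>. \<forall>\<beta> :: 'n \<Rightarrow> nat. sum \<beta> UNIV = k \<longrightarrow>
     (\<integral>x. monomial (\<lambda>i. 2 * \<beta> i) x \<partial>M) = \<kappa> * (\<Prod>i\<in>UNIV. odd_fact (\<beta> i))"
proof -
  define i0 :: 'n where "i0 = undefined"
  define \<kappa> where "\<kappa> = (\<integral>x. monomial (\<lambda>i. 2 * ((\<lambda>_. 0)(i0 := k)) i) x \<partial>M) / odd_fact k"
  have "(\<integral>x. monomial (\<lambda>i. 2 * \<beta> i) x \<partial>M) = \<kappa> * (\<Prod>i\<in>UNIV. odd_fact (\<beta> i))"
    if "sum \<beta> UNIV = k" for \<beta> :: "'n \<Rightarrow> nat"
    using that
  proof (induction "card {i. i \<noteq> i0 \<and> \<beta> i \<noteq> 0}" arbitrary: \<beta>)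
    case 0
    hence z: "\<beta> i = 0" if "i \<noteq> i0" for i using that by auto
    have "sum \<beta> UNIV = \<beta> i0 + sum \<beta> (UNIV - {i0})" by (rule sum.remove) auto
    also have "sum \<beta> (UNIV - {i0}) = 0" using z by auto
    finally have "\<beta> i0 = k" using 0 by simp
    hence b: "\<beta> = (\<lambda>_. 0)(i0 := k)" using z by auto
    have "(\<Prod>i\<in>UNIV. odd_fact (\<beta> i)) = odd_fact (\<beta> i0) * (\<Prod>i\<in>UNIV - {i0}. odd_fact (\<beta> i))"
      by (rule prod.remove) auto
    also have "(\<Prod>i\<in>UNIV - {i0}. odd_fact (\<beta> i)) = 1" using z by (intro prod.neutral) auto
    finally show ?case using odd_fact_pos[of k] unfolding b \<kappa>_def by simp
  next
    case (Suc n)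
    have "{i. i \<noteq> i0 \<and> \<beta> i \<noteq> 0} \<noteq> {}"
      using Suc(2) by (metis card.empty nat.distinct(1))
    then obtain j where j: "j \<noteq> i0" "\<beta> j \<noteq> 0" by blast
    let ?\<beta> = "\<beta>(i0 := \<beta> i0 + \<beta> j, j := 0)"
    have "{i. i \<noteq> i0 \<and> ?\<beta> i \<noteq> 0} = {i. i \<noteq> i0 \<and> \<beta> i \<noteq> 0} - {j}" by auto
    hence n: "n = card {i. i \<noteq> i0 \<and> ?\<beta> i \<noteq> 0}"
      using Suc(2) j by (simp add: card_Diff_singleton)
    have ij: "i0 \<noteq> j" using j by simp
    have s: "sum ?\<beta> UNIV = k"
    proof -
      have "sum ?\<beta> (UNIV - {i0, j}) = sum \<beta> (UNIV - {i0, j})" by (rule sum.cong) auto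
      thus ?thesis using Suc(3) ij by (simp add: sum_UNIV_two[OF ij])
    qed
    let ?Q = "\<Prod>i\<in>UNIV - {i0, j}. odd_fact (\<beta> i)"
    have q: "(\<Prod>i\<in>UNIV. odd_fact (?\<beta> i)) = odd_fact (\<beta> i0 + \<beta> j) * ?Q"
    proof -
      have "(\<Prod>i\<in>UNIV - {i0, j}. odd_fact (?\<beta> i)) = ?Q" by (rule prod.cong) auto
      thus ?thesis using ij by (simp add: prod_UNIV_two[OF ij])
    qed
    have "(\<integral>x. monomial (\<lambda>i. 2 * \<beta> i) x \<partial>M) * odd_fact (\<beta> i0 + \<beta> j)
        = \<kappa> * (odd_fact (\<beta> i0 + \<beta> j) * ?Q) * (odd_fact (\<beta> i0) * odd_fact (\<beta> j))"
      using integral_monomial_merge[OF ij, of \<beta>] Suc(1)[OF n s] unfolding q by simp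
    also have "\<dots> = (\<kappa> * (\<Prod>i\<in>UNIV. odd_fact (\<beta> i))) * odd_fact (\<beta> i0 + \<beta> j)"
      by (simp add: prod_UNIV_two[OF ij, of "\<lambda>i. odd_fact (\<beta> i)"])
    finally show ?case using odd_fact_pos[of "\<beta> i0 + \<beta> j"] by simp
  qed
  thus ?thesis by blast
qed

end


section \<open>A criterion for cubature formulas\<close>

lemma monomial_0 [simp]: "monomial (\<lambda>_. 0) x = 1"
  by (simp add: monomial_def)

lemma sum_fun_upd_Suc:
  fixes \<beta> :: "'n::finite \<Rightarrow> nat"
  shows "sum (\<beta>(i := Suc (\<beta> i))) UNIV = Suc (sum \<beta> UNIV)"
proof -
  have "sum (\<beta>(i := Suc (\<beta> i))) (UNIV - {i}) = sum \<beta> (UNIV - {i})" by (rule sum.cong) auto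
  thus ?thesis
    using sum.remove[of UNIV i \<beta>] sum.remove[of UNIV i "\<beta>(i := Suc (\<beta> i))"] by simp
qed

lemma monomial_Suc:
  "monomial (\<lambda>k. 2 * (\<beta>(i := Suc (\<beta> i))) k) x = monomial (\<lambda>k. 2 * \<beta> k) x * (x $ i)\<^sup>2"
proof -
  have "(\<Prod>k\<in>UNIV - {i}. (x $ k) ^ (2 * (\<beta>(i := Suc (\<beta> i))) k)) = (\<Prod>k\<in>UNIV - {i}. (x $ k) ^ (2 * \<beta> k))"
    by (rule prod.cong) auto
  thus ?thesis
    unfolding monomial_def
    using prod.remove[of UNIV i "\<lambda>k. (x $ k) ^ (2 * \<beta> k)"]
      prod.remove[of UNIV i "\<lambda>k. (x $ k) ^ (2 * (\<beta>(i := Suc (\<beta> i))) k)"]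
    by (simp add: power2_eq_square)
qed

lemma inner_times_monomial:
  "(x \<bullet> x) * monomial (\<lambda>k. 2 * \<beta> k) x
   = (\<Sum>i\<in>UNIV. monomial (\<lambda>k. 2 * (\<beta>(i := Suc (\<beta> i))) k) x)"
  unfolding monomial_Suc by (simp add: inner_vec_def sum_distrib_left power2_eq_square mult.commute)

text \<open>The hypothesis \<open>step\<close> is what multiplication by x \<bullet> x = r does to a
  linear combination of moment functionals: each value is, up to the factor r, a sum of values one
  even degree higher. Vanishing therefore descends from the top degree.\<close>

lemma moments_vanish_downward:
  fixes F :: "('n::finite \<Rightarrow> nat) \<Rightarrow> real"
  assumes r: "r \<noteq> 0"
    and top: "\<And>\<beta>. sum \<beta> UNIV = k \<Longrightarrow> F \<beta> = 0"
    and step: "\<And>\<beta>. r * F \<beta> = (\<Sum>i\<in>UNIV. F (\<beta>(i := Suc (\<beta> i))))"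
    and le: "sum \<beta> UNIV \<le> k"
  shows "F \<beta> = 0"
  using le
proof (induction "k - sum \<beta> UNIV" arbitrary: \<beta>)
  case 0
  thus ?case by (intro top) simp
next
  case (Suc n)
  have "F (\<beta>(i := Suc (\<beta> i))) = 0" for i
  proof (rule Suc(1))
    have "sum \<beta> UNIV < k" using Suc(2) by simp
    thus "n = k - sum (\<beta>(i := Suc (\<beta> i))) UNIV" "sum (\<beta>(i := Suc (\<beta> i))) UNIV \<le> k"
      using Suc(2) by (simp_all only: sum_fun_upd_Suc)
  qed
  hence "r * F \<beta> = 0" by (simp only: step sum.neutral_const)
  thus ?case using r by simp
qed

text \<open>
  On the sphere, multiplication by \<open>x \<bullet> x / r\<close> turns a moment of degree \<open>2 j\<close> into moments of degree
  \<open>2 j + 2\<close>, so only the top even degree has to be compared with the sphere, and only up to a factor.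
\<close>

lemma cubature_formula_criterion:
  fixes X :: "(real^'n::{finite,wellorder}) set"
  assumes r: "r > 0" and X: "finite X" "X \<subseteq> sqsphere r" and W: "\<And>x. x \<in> X \<Longrightarrow> W x > 0" "sum W X = 1"
    and t: "t \<le> 2 * k + 1"
    and odd: "\<And>\<alpha> i. odd (\<alpha> i) \<Longrightarrow> (\<Sum>x\<in>X. W x * monomial \<alpha> x) = 0"
    and even: "\<And>\<beta>. sum \<beta> UNIV = k \<Longrightarrow>
      (\<Sum>x\<in>X. W x * monomial (\<lambda>i. 2 * \<beta> i) x) = \<kappa> * (\<Prod>i\<in>UNIV. odd_fact (\<beta> i))"
  shows "cubature_formula t r X W"
proof -
  let ?M = "sphere_measure r :: (real^'n::_) measure"
  note M = rotation_invariant_prob_sphere_measure[OF r, where 'n = 'n]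
  interpret M: prob_space ?M by (rule rip_prob[OF M])
  note int [simp] = integrable_monomial[OF r M]
  define S where "S \<alpha> = (\<Sum>x\<in>X. W x * monomial \<alpha> x)" for \<alpha>
  define I where "I \<alpha> = (\<integral>x. monomial \<alpha> x \<partial>?M)" for \<alpha>
  obtain \<kappa>' where \<kappa>': "\<And>\<beta> :: 'n \<Rightarrow> nat. sum \<beta> UNIV = k \<Longrightarrow>
      I (\<lambda>i. 2 * \<beta> i) = \<kappa>' * (\<Prod>i\<in>UNIV. odd_fact (\<beta> i))"
    using integral_monomial_even[OF r M, of k] unfolding I_def by blast
  have stepS: "r * S (\<lambda>k. 2 * \<beta> k) = (\<Sum>i\<in>UNIV. S (\<lambda>k. 2 * (\<beta>(i := Suc (\<beta> i))) k))" for \<beta>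
  proof -
    have "r * S (\<lambda>k. 2 * \<beta> k) = (\<Sum>x\<in>X. W x * ((x \<bullet> x) * monomial (\<lambda>k. 2 * \<beta> k) x))"
      unfolding S_def sum_distrib_left using X(2)
      by (intro sum.cong) (auto simp: sqsphere_def)
    also have "\<dots> = (\<Sum>i\<in>UNIV. S (\<lambda>k. 2 * (\<beta>(i := Suc (\<beta> i))) k))"
      unfolding inner_times_monomial S_def sum_distrib_left by (rule sum.swap)
    finally show ?thesis .
  qed
  have stepI: "r * I (\<lambda>k. 2 * \<beta> k) = (\<Sum>i\<in>UNIV. I (\<lambda>k. 2 * (\<beta>(i := Suc (\<beta> i))) k))" for \<beta>
  proof -
    have "r * I (\<lambda>k. 2 * \<beta> k) = (\<integral>x. r * monomial (\<lambda>k. 2 * \<beta> k) x \<partial>?M)"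
      by (simp add: I_def)
    also have "\<dots> = (\<integral>x. (\<Sum>i\<in>UNIV. monomial (\<lambda>k. 2 * (\<beta>(i := Suc (\<beta> i))) k) x) \<partial>?M)"
      unfolding inner_times_monomial[symmetric]
      by (intro Bochner_Integration.integral_cong) (auto simp: rip_space[OF M] sqsphere_def)
    also have "\<dots> = (\<Sum>i\<in>UNIV. I (\<lambda>k. 2 * (\<beta>(i := Suc (\<beta> i))) k))"
      unfolding I_def by (rule Bochner_Integration.integral_sum) (rule int)
    finally show ?thesis .
  qed
  have S0: "S (\<lambda>k. 2 * (\<lambda>_. 0) k) = 1" and I0: "I (\<lambda>k. 2 * (\<lambda>_. 0) k) = 1"
    using W(2) M.prob_space by (simp_all add: S_def I_def)
  have r0: "r \<noteq> 0" using r by simp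
  \<comment> \<open>Cross-multiplying by the two unknown factors makes the top moments cancel
    without dividing by either of them. In degree 0 both moments are the total mass 1, and the
    combination reads \<kappa>' - \<kappa>.\<close>
  have "\<kappa>' * S (\<lambda>k. 2 * \<beta> k) - \<kappa> * I (\<lambda>k. 2 * \<beta> k) = 0" if "sum \<beta> UNIV \<le> k" for \<beta>
  proof (rule moments_vanish_downward[where F = "\<lambda>\<beta>. \<kappa>' * S (\<lambda>k. 2 * \<beta> k) - \<kappa> * I (\<lambda>k. 2 * \<beta> k)", OF r0 _ _ that])
    show "\<kappa>' * S (\<lambda>k. 2 * \<beta> k) - \<kappa> * I (\<lambda>k. 2 * \<beta> k) = 0" if "sum \<beta> UNIV = k" for \<beta>
      using \<kappa>'[OF that] even[OF that] by (simp add: S_def)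
    show "r * (\<kappa>' * S (\<lambda>k. 2 * \<beta> k) - \<kappa> * I (\<lambda>k. 2 * \<beta> k)) = (\<Sum>i\<in>UNIV.
        \<kappa>' * S (\<lambda>k. 2 * (\<beta>(i := Suc (\<beta> i))) k) - \<kappa> * I (\<lambda>k. 2 * (\<beta>(i := Suc (\<beta> i))) k))" for \<beta>
      unfolding sum_subtractf sum_distrib_left[symmetric] stepS[symmetric] stepI[symmetric]
      by (simp add: algebra_simps)
  qed
  from this[of "\<lambda>_. 0"] have "\<kappa>' = \<kappa>" unfolding S0 I0 by simp
  have eq: "S (\<lambda>k. 2 * \<beta> k) - I (\<lambda>k. 2 * \<beta> k) = 0" if "sum \<beta> UNIV \<le> k" for \<beta>
  proof (rule moments_vanish_downward[where F = "\<lambda>\<beta>. S (\<lambda>k. 2 * \<beta> k) - I (\<lambda>k. 2 * \<beta> k)", OF r0 _ _ that])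
    show "S (\<lambda>k. 2 * \<beta> k) - I (\<lambda>k. 2 * \<beta> k) = 0" if "sum \<beta> UNIV = k" for \<beta>
      using \<kappa>'[OF that] even[OF that] \<open>\<kappa>' = \<kappa>\<close> by (simp add: S_def)
    show "r * (S (\<lambda>k. 2 * \<beta> k) - I (\<lambda>k. 2 * \<beta> k)) = (\<Sum>i\<in>UNIV.
        S (\<lambda>k. 2 * (\<beta>(i := Suc (\<beta> i))) k) - I (\<lambda>k. 2 * (\<beta>(i := Suc (\<beta> i))) k))" for \<beta>
      unfolding sum_subtractf sum_distrib_left[symmetric] stepS[symmetric] stepI[symmetric]
      by (simp add: algebra_simps)
  qed
  have SI: "S \<alpha> = I \<alpha>" if le: "sum \<alpha> UNIV \<le> t" for \<alpha>
  proof (cases "\<exists>i. odd (\<alpha> i)")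
    case True
    then obtain i where "odd (\<alpha> i)" by blast
    thus ?thesis
      using odd integral_monomial_odd[OF r M] by (simp add: S_def I_def)
  next
    case False
    hence \<alpha>: "\<alpha> = (\<lambda>i. 2 * (\<alpha> i div 2))" by auto
    have "2 * (\<Sum>i\<in>UNIV. \<alpha> i div 2) = sum \<alpha> UNIV"
      unfolding sum_distrib_left using False by (intro sum.cong) auto
    \<comment> \<open>An even degree that is at most \<open>2 * k + 1\<close> is at most
      \<open>2 * k\<close>; the last odd degree is thus obtained from symmetry alone.\<close>
    hence "(\<Sum>i\<in>UNIV. \<alpha> i div 2) \<le> k" using le t by linarith
    from eq[OF this] show ?thesis using \<alpha> by simp
  qed
  show ?thesis
    unfolding cubature_formula_def
  proof (intro conjI allI impI ballI)
    show "finite X" "X \<subseteq> sqsphere r" by fact+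
    show "\<And>x. x \<in> X \<Longrightarrow> W x > 0" by fact
    fix f :: "real^'n::_ \<Rightarrow> complex" assume "poly_fun_deg_le t f"
    then obtain c where f: "\<And>x. f x = (\<Sum>\<alpha> | sum \<alpha> UNIV \<le> t. c \<alpha> * complex_of_real (monomial \<alpha> x))"
      unfolding poly_fun_deg_le_def monomial_def by (auto simp: fun_eq_iff)
    have "(\<Sum>x\<in>X. complex_of_real (W x) * f x)
        = (\<Sum>x\<in>X. \<Sum>\<alpha> | sum \<alpha> UNIV \<le> t. c \<alpha> * complex_of_real (W x * monomial \<alpha> x))"
      unfolding f sum_distrib_left by (simp add: mult_ac)
    also have "\<dots> = (\<Sum>\<alpha> | sum \<alpha> UNIV \<le> t. c \<alpha> * complex_of_real (S \<alpha>))"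
      unfolding S_def of_real_sum sum_distrib_left by (rule sum.swap)
    also have "\<dots> = (\<Sum>\<alpha> | sum \<alpha> UNIV \<le> t. c \<alpha> * complex_of_real (I \<alpha>))"
      by (intro sum.cong) (auto simp: SI)
    also have "\<dots> = (\<Sum>\<alpha> | sum \<alpha> UNIV \<le> t. (\<integral>x. c \<alpha> * complex_of_real (monomial \<alpha> x) \<partial>?M))"
      by (simp add: I_def)
    also have "\<dots> = (\<integral>x. f x \<partial>?M)"
      unfolding f by (rule Bochner_Integration.integral_sum[symmetric]) simp
    finally show "(\<Sum>x\<in>X. complex_of_real (W x) * f x) = (\<integral>x. f x \<partial>?M)" .
  qed
qed


section \<open>Lagrange's four square theorem\<close>

definition sum4sq :: "int \<Rightarrow> bool" where
  "sum4sq n \<longleftrightarrow> (\<exists>a b c d. n = a\<^sup>2 + b\<^sup>2 + c\<^sup>2 + d\<^sup>2)"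

text \<open>Multiplicativity of the quaternion norm, for the product of w + xi + yj + zk with the
  conjugate of a + bi + cj + dk. The conjugate is chosen so that all four entries are divisible by m
  when (w, x, y, z) is congruent to (a, b, c, d) modulo m and the norm of the latter is a multiple
  of m.\<close>

lemma euler_four_square:
  fixes a b c d w x y z :: "'a::comm_ring_1"
  shows "(a\<^sup>2 + b\<^sup>2 + c\<^sup>2 + d\<^sup>2) * (w\<^sup>2 + x\<^sup>2 + y\<^sup>2 + z\<^sup>2) =
    (a*w + b*x + c*y + d*z)\<^sup>2 + (a*x - b*w + c*z - d*y)\<^sup>2 +
    (a*y - b*z - c*w + d*x)\<^sup>2 + (a*z + b*y - c*x - d*w)\<^sup>2"
  by (simp add: power2_eq_square algebra_simps)

lemma sum4sq_mult: "sum4sq m \<Longrightarrow> sum4sq n \<Longrightarrow> sum4sq (m * n)"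
  unfolding sum4sq_def by (elim exE) (simp only: euler_four_square, blast)

text \<open>The residue is taken in the interval from -m/2 to m/2. The last property serves the
  boundary case of the descent: if 2y = m and x - y = mk, then x + y = m(k + 1), so both factors of
  the difference of squares are multiples of m.\<close>

lemma centered_residue:
  fixes x m :: int
  assumes "m > 0"
  obtains y where "[y = x] (mod m)" "4 * y\<^sup>2 \<le> m\<^sup>2" "4 * y\<^sup>2 = m\<^sup>2 \<Longrightarrow> m\<^sup>2 dvd x\<^sup>2 - y\<^sup>2"
proof -
  define y where "y = (if 2 * (x mod m) \<le> m then x mod m else x mod m - m)"
  have xm: "0 \<le> x mod m" "x mod m < m" using assms by auto
  have cong: "[y = x] (mod m)"
    by (simp add: y_def cong_def)
  have ab: "\<bar>2 * y\<bar> \<le> \<bar>m\<bar>" using xm by (auto simp: y_def)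
  have "4 * y\<^sup>2 = (2 * y)\<^sup>2" by (simp add: power2_eq_square)
  moreover have "(2 * y)\<^sup>2 \<le> m\<^sup>2" using ab by (simp only: abs_le_square_iff)
  moreover have "m\<^sup>2 dvd x\<^sup>2 - y\<^sup>2" if "(2 * y)\<^sup>2 = m\<^sup>2"
  proof -
    have "2 * y = m \<or> 2 * y = - m" using that by (simp only: power2_eq_iff)
    moreover have "- m < 2 * y"
    proof (cases "2 * (x mod m) \<le> m")
      case True
      hence "y = x mod m" by (simp add: y_def)
      thus ?thesis using xm assms by linarith
    next
      case False
      hence "y = x mod m - m" by (simp add: y_def)
      thus ?thesis using False by linarith
    qed
    ultimately have "2 * y = m" by auto
    moreover obtain k where k: "x - y = m * k"
      using cong by (metis cong_iff_dvd_diff cong_sym dvdE)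
    ultimately have "x + y = m * (k + 1)" by (simp add: algebra_simps)
    hence "x\<^sup>2 - y\<^sup>2 = m\<^sup>2 * (k * (k + 1))"
      using k by (simp add: power2_eq_square square_diff_square_factored)
    thus ?thesis by simp
  qed
  ultimately show ?thesis using that cong by simp
qed

text \<open>Pigeonhole: the squares of 0, ..., (p-1)/2 are pairwise incongruent modulo p, and so are
  the numbers -1 - y^2. Two sets of (p+1)/2 residues cannot be disjoint. The bounds on x and y make
  the quotient by p smaller than p, as the descent requires.\<close>

lemma prime_dvd_sum_two_squares_plus_one:
  fixes p :: int
  assumes p: "prime p" "p > 2"
  obtains x y where "p dvd x\<^sup>2 + y\<^sup>2 + 1" "0 \<le> x" "2 * x < p" "0 \<le> y" "2 * y < p"
proof -
  define S where "S = {x::int. 0 \<le> x \<and> 2 * x < p}"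
  have oddp: "odd p" using p by (simp add: prime_odd_int)
  have S: "S = {0..(p - 1) div 2}" using oddp by (auto simp: S_def elim!: oddE)
  have fin: "finite S" by (simp add: S)
  have cS: "2 * int (card S) = p + 1" using oddp p by (auto simp: S elim!: oddE)
  have inj: "x = y" if "x \<in> S" "y \<in> S" "p dvd x\<^sup>2 - y\<^sup>2" for x y
  proof -
    have "p dvd (x - y) * (x + y)"
      using that by (simp add: power2_eq_square square_diff_square_factored mult.commute)
    hence "p dvd x - y \<or> p dvd x + y" using p(1) by (simp add: prime_dvd_mult_iff)
    thus ?thesis
    proof
      assume d: "p dvd x - y"
      thus ?thesis
        using that dvd_imp_le_int[of "x - y" p] by (force simp: S_def)
    next
      assume d: "p dvd x + y"
      thus ?thesis using that zdvd_not_zless[of "x + y" p] by (force simp: S_def)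
    qed
  qed
  define f where "f x = x\<^sup>2 mod p" for x
  define g where "g x = (- 1 - x\<^sup>2) mod p" for x
  have if': "inj_on f S"
    by (rule inj_onI) (auto simp: f_def mod_eq_dvd_iff intro: inj)
  have ig: "inj_on g S"
  proof (rule inj_onI)
    fix x y assume "x \<in> S" "y \<in> S" "g x = g y"
    hence "p dvd y\<^sup>2 - x\<^sup>2" by (simp add: g_def mod_eq_dvd_iff)
    thus "x = y" using inj \<open>x \<in> S\<close> \<open>y \<in> S\<close> by metis
  qed
  have "f ` S \<inter> g ` S \<noteq> {}"
  proof
    assume "f ` S \<inter> g ` S = {}"
    hence "card (f ` S \<union> g ` S) = card S + card S"
      using fin by (simp add: card_Un_disjoint card_image if' ig)
    moreover have "card (f ` S \<union> g ` S) \<le> card {0..<p}"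
      using p by (intro card_mono) (auto simp: f_def g_def)
    ultimately show False using cS p by simp
  qed
  then obtain x y where xy: "x \<in> S" "y \<in> S" "f x = g y" by blast
  hence "p dvd x\<^sup>2 + y\<^sup>2 + 1"
    by (simp add: f_def g_def mod_eq_dvd_iff algebra_simps)
  thus ?thesis using xy that by (simp add: S_def)
qed

text \<open>Apply Euler's identity to a representation of \<open>m * p\<close> and its centered residues modulo \<open>m\<close>.\<close>

lemma sum4sq_descent:
  fixes m p :: int
  assumes p: "prime p" and m: "1 < m" "m < p" and s: "sum4sq (m * p)"
  obtains k where "0 < k" "k < m" "sum4sq (k * p)"
proof -
  obtain a b c d where abcd: "m * p = a\<^sup>2 + b\<^sup>2 + c\<^sup>2 + d\<^sup>2" using s unfolding sum4sq_def by blast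
  have m0: "m > 0" using m by simp
  obtain w where w: "[w = a] (mod m)" "4 * w\<^sup>2 \<le> m\<^sup>2" "4 * w\<^sup>2 = m\<^sup>2 \<Longrightarrow> m\<^sup>2 dvd a\<^sup>2 - w\<^sup>2"
    using centered_residue[OF m0] by metis
  obtain x where x: "[x = b] (mod m)" "4 * x\<^sup>2 \<le> m\<^sup>2" "4 * x\<^sup>2 = m\<^sup>2 \<Longrightarrow> m\<^sup>2 dvd b\<^sup>2 - x\<^sup>2"
    using centered_residue[OF m0] by metis
  obtain y where y: "[y = c] (mod m)" "4 * y\<^sup>2 \<le> m\<^sup>2" "4 * y\<^sup>2 = m\<^sup>2 \<Longrightarrow> m\<^sup>2 dvd c\<^sup>2 - y\<^sup>2"
    using centered_residue[OF m0] by metis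
  obtain z where z: "[z = d] (mod m)" "4 * z\<^sup>2 \<le> m\<^sup>2" "4 * z\<^sup>2 = m\<^sup>2 \<Longrightarrow> m\<^sup>2 dvd d\<^sup>2 - z\<^sup>2"
    using centered_residue[OF m0] by metis
  \<comment> \<open>This excludes both extreme values of the new multiplier k: for k = 0 all
    residues vanish, for k = m all of them have absolute value m/2, and in either case m^2 would
    divide m * p.\<close>
  have ndvd: "\<not> m\<^sup>2 dvd m * p"
  proof
    assume "m\<^sup>2 dvd m * p"
    hence "m dvd p" using m0 by (simp add: power2_eq_square)
    hence "m = 1 \<or> m = p" using p m0 unfolding prime_int_iff by (meson less_imp_le)
    thus False using m by simp
  qed
  have "[w\<^sup>2 + x\<^sup>2 + y\<^sup>2 + z\<^sup>2 = a\<^sup>2 + b\<^sup>2 + c\<^sup>2 + d\<^sup>2] (mod m)"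
    by (intro cong_add cong_pow w x y z)
  hence "m dvd w\<^sup>2 + x\<^sup>2 + y\<^sup>2 + z\<^sup>2"
    unfolding abcd[symmetric] by (simp add: cong_dvd_iff)
  then obtain k where k: "w\<^sup>2 + x\<^sup>2 + y\<^sup>2 + z\<^sup>2 = m * k" by (elim dvdE)
  have "m * k \<ge> 0" unfolding k[symmetric] by simp
  hence k0: "k \<ge> 0" using m0 by (simp add: zero_le_mult_iff)
  have "m * k \<le> m * m" using w(2) x(2) y(2) z(2) unfolding k[symmetric] by (simp add: power2_eq_square)
  hence km: "k \<le> m" using m0 by simp
  have "k \<noteq> 0"
  proof
    assume "k = 0"
    hence "w\<^sup>2 + x\<^sup>2 + y\<^sup>2 + z\<^sup>2 = 0" using k by simp
    moreover have "w\<^sup>2 \<ge> 0" "x\<^sup>2 \<ge> 0" "y\<^sup>2 \<ge> 0" "z\<^sup>2 \<ge> 0" by simp_all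
    ultimately have "w\<^sup>2 = 0" "x\<^sup>2 = 0" "y\<^sup>2 = 0" "z\<^sup>2 = 0" by linarith+
    hence "m dvd a" "m dvd b" "m dvd c" "m dvd d"
      using w(1) x(1) y(1) z(1) by (simp_all add: cong_0_iff cong_sym_eq[of 0])
    hence "m\<^sup>2 dvd m * p" unfolding abcd by (intro dvd_add) simp_all
    thus False using ndvd by simp
  qed
  have "k \<noteq> m"
  proof
    assume "k = m"
    hence "w\<^sup>2 + x\<^sup>2 + y\<^sup>2 + z\<^sup>2 = m\<^sup>2" using k by (simp add: power2_eq_square)
    hence e: "4 * w\<^sup>2 = m\<^sup>2" "4 * x\<^sup>2 = m\<^sup>2" "4 * y\<^sup>2 = m\<^sup>2" "4 * z\<^sup>2 = m\<^sup>2" and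
      s: "m\<^sup>2 = w\<^sup>2 + x\<^sup>2 + y\<^sup>2 + z\<^sup>2"
      using w(2) x(2) y(2) z(2) by linarith+
    have "m\<^sup>2 dvd (a\<^sup>2 - w\<^sup>2) + (b\<^sup>2 - x\<^sup>2) + (c\<^sup>2 - y\<^sup>2) + (d\<^sup>2 - z\<^sup>2) + m\<^sup>2"
      using w(3) x(3) y(3) z(3) e by (intro dvd_add) auto
    also have "\<dots> = m * p" unfolding abcd s by simp
    finally show False using ndvd by simp
  qed
  have c0: "[a*w + b*x + c*y + d*z = 0] (mod m)"
  proof -
    have "[a*w + b*x + c*y + d*z = a*a + b*b + c*c + d*d] (mod m)"
      by (intro cong_add cong_mult cong_refl w x y z)
    also have "a*a + b*b + c*c + d*d = m * p" unfolding abcd by (simp add: power2_eq_square)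
    also have "[m * p = 0] (mod m)" by (simp add: cong_0_iff)
    finally show ?thesis .
  qed
  have c1: "[a*x - b*w + c*z - d*y = a*b - b*a + c*d - d*c] (mod m)"
    by (intro cong_add cong_diff cong_mult cong_refl w x y z)
  have c2: "[a*y - b*z - c*w + d*x = a*c - b*d - c*a + d*b] (mod m)"
    by (intro cong_add cong_diff cong_mult cong_refl w x y z)
  have c3: "[a*z + b*y - c*x - d*w = a*d + b*c - c*b - d*a] (mod m)"
    by (intro cong_add cong_diff cong_mult cong_refl w x y z)
  have "m dvd a*w + b*x + c*y + d*z" "m dvd a*x - b*w + c*z - d*y"
      "m dvd a*y - b*z - c*w + d*x" "m dvd a*z + b*y - c*x - d*w"
    using c0 c1 c2 c3 by (simp_all add: cong_0_iff mult.commute)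
  then obtain A B C D where ABCD: "a*w + b*x + c*y + d*z = m * A" "a*x - b*w + c*z - d*y = m * B"
      "a*y - b*z - c*w + d*x = m * C" "a*z + b*y - c*x - d*w = m * D"
    by (elim dvdE)
  have "m\<^sup>2 * (k * p) = (m * p) * (m * k)" by (simp add: power2_eq_square)
  also have "\<dots> = (m * A)\<^sup>2 + (m * B)\<^sup>2 + (m * C)\<^sup>2 + (m * D)\<^sup>2"
    unfolding abcd k[symmetric] euler_four_square ABCD ..
  also have "\<dots> = m\<^sup>2 * (A\<^sup>2 + B\<^sup>2 + C\<^sup>2 + D\<^sup>2)" by (simp add: power_mult_distrib algebra_simps)
  finally have "k * p = A\<^sup>2 + B\<^sup>2 + C\<^sup>2 + D\<^sup>2" using m0 by simp
  thus ?thesis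
    using that[of k] k0 km \<open>k \<noteq> 0\<close> \<open>k \<noteq> m\<close> unfolding sum4sq_def by auto
qed

text \<open>Some multiple m * p with 0 < m < p has the form x^2 + y^2 + 1^2 + 0^2, and the descent
  lowers m until it reaches 1.\<close>

lemma sum4sq_prime:
  fixes p :: int
  assumes p: "prime p"
  shows "sum4sq p"
proof (cases "p = 2")
  case True
  have "(2::int) = 1\<^sup>2 + 1\<^sup>2 + 0\<^sup>2 + 0\<^sup>2" by simp
  thus ?thesis unfolding sum4sq_def True by blast
next
  case False
  hence p2: "p > 2" using prime_ge_2_int[OF p] by simp
  have desc: "sum4sq p" if "0 < m" "m < p" "sum4sq (m * p)" for m
    using that
  proof (induction "nat m" arbitrary: m rule: less_induct)
    case less
    show ?case
    proof (cases "m = 1")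
      case False
      hence "1 < m" using less by simp
      then obtain k where "0 < k" "k < m" "sum4sq (k * p)"
        using sum4sq_descent[OF p _ less(3,4)] by blast
      thus ?thesis using less by simp
    qed (use less in simp)
  qed
  obtain x y where xy: "p dvd x\<^sup>2 + y\<^sup>2 + 1" "0 \<le> x" "2 * x < p" "0 \<le> y" "2 * y < p"
    using prime_dvd_sum_two_squares_plus_one[OF p p2] by metis
  then obtain m where m: "x\<^sup>2 + y\<^sup>2 + 1 = p * m" by (elim dvdE)
  have "p * m > 0" unfolding m[symmetric] by (simp add: add_nonneg_pos)
  hence m0: "m > 0" using p2 by (simp add: zero_less_mult_iff)
  have "(2 * x)\<^sup>2 < p\<^sup>2" "(2 * y)\<^sup>2 < p\<^sup>2"
    using xy p2 power_strict_mono[of "2 * x" p 2] power_strict_mono[of "2 * y" p 2] by simp_all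
  moreover have "4 \<le> p\<^sup>2" using p2 power_mono[of 2 p 2] by simp
  ultimately have "4 * (x\<^sup>2 + y\<^sup>2 + 1) < 4 * p\<^sup>2" by (simp add: power_mult_distrib)
  hence "p * m < p * p" unfolding m by (simp add: power2_eq_square)
  hence "m < p" using p2 by simp
  moreover have "m * p = x\<^sup>2 + y\<^sup>2 + 1\<^sup>2 + 0\<^sup>2" using m by (simp add: mult.commute)
  hence "sum4sq (m * p)" unfolding sum4sq_def by blast
  ultimately show ?thesis using desc m0 by blast
qed

theorem lagrange_four_squares: "sum4sq (int n)"
proof (induction n rule: prime_divisors_induct)
  case zero
  have "int 0 = 0\<^sup>2 + 0\<^sup>2 + 0\<^sup>2 + 0\<^sup>2" by simp
  thus ?case unfolding sum4sq_def by blast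
next
  case (unit n)
  have "int n = 1\<^sup>2 + 0\<^sup>2 + 0\<^sup>2 + 0\<^sup>2" using unit by simp
  thus ?case unfolding sum4sq_def by blast
next
  case (factor p n)
  thus ?case using sum4sq_mult sum4sq_prime by simp
qed


section \<open>Symmetries of the shells\<close>

definition coord_swap :: "'n::finite \<Rightarrow> 'n \<Rightarrow> real^'n \<Rightarrow> real^'n" where
  "coord_swap i j x = (\<chi> k. x $ Transposition.transpose i j k)"

definition vec4 :: "'a \<Rightarrow> 'a \<Rightarrow> 'a \<Rightarrow> 'a \<Rightarrow> 'a^4" where
  "vec4 a b c d = (\<chi> i. if i = 1 then a else if i = 2 then b else if i = 3 then c else d)"

text \<open>A normalized 2x2 Hadamard matrix acts on each of the coordinate pairs (1, 2) and (3, 4).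
  It is symmetric with square 1, hence an orthogonal involution.\<close>

definition tau :: "real^4 \<Rightarrow> real^4" where
  "tau x = (1 / sqrt 2) *\<^sub>R vec4 (x $ 1 + x $ 2) (x $ 1 - x $ 2) (x $ 3 + x $ 4) (x $ 3 - x $ 4)"

lemma vec4_nth [simp]:
  "vec4 a b c d $ 1 = a" "vec4 a b c d $ 2 = b" "vec4 a b c d $ 3 = c" "vec4 a b c d $ 4 = d"
  by (simp_all add: vec4_def)

lemma vec4_eqI:
  fixes x y :: "'a^4"
  shows "x $ 1 = y $ 1 \<Longrightarrow> x $ 2 = y $ 2 \<Longrightarrow> x $ 3 = y $ 3 \<Longrightarrow> x $ 4 = y $ 4 \<Longrightarrow> x = y"
  by (simp add: vec_eq_iff forall_4)

lemma inner_4: "x \<bullet> y = x $ 1 * y $ 1 + x $ 2 * y $ 2 + x $ 3 * y $ 3 + x $ 4 * y $ 4"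
  for x y :: "real^4"
  by (simp add: inner_vec_def sum_4)

lemma tau_nth [simp]:
  "tau x $ 1 = (x $ 1 + x $ 2) / sqrt 2" "tau x $ 2 = (x $ 1 - x $ 2) / sqrt 2"
  "tau x $ 3 = (x $ 3 + x $ 4) / sqrt 2" "tau x $ 4 = (x $ 3 - x $ 4) / sqrt 2"
  by (simp_all add: tau_def)

lemma tau_tau [simp]: "tau (tau x) = x"
  by (rule vec4_eqI) (simp_all add: field_simps)

lemma tau_inner: "tau x \<bullet> y = x \<bullet> tau y"
  by (simp add: inner_4 field_simps)

lemma coord_swap_coord_swap [simp]: "coord_swap i j (coord_swap i j x) = x"
  by (simp add: coord_swap_def vec_eq_iff)

lemma coord_swap_inner: "coord_swap i j x \<bullet> y = x \<bullet> coord_swap i j y"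
  unfolding inner_vec_def
  by (rule sum.reindex_bij_witness[of _ "Transposition.transpose i j" "Transposition.transpose i j"]) (auto simp: coord_swap_def)

lemma coord_swap_scaleR: "coord_swap i j (c *\<^sub>R x) = c *\<^sub>R coord_swap i j x"
  by (simp add: coord_swap_def vec_eq_iff)

lemma coord_flip_inner: "coord_flip i x \<bullet> y = x \<bullet> coord_flip i y"
  unfolding inner_vec_def by (rule sum.cong) (auto simp: coord_flip_def)

section \<open>The lattice D_4, its dual, and the maps preserving their union\<close>

lemma D4_iff: "x \<in> D4 \<longleftrightarrow> (\<exists>a b c d. x = vec4 (of_int a) (of_int b) (of_int c) (of_int d) \<and> even (a + b + c + d))"
proof
  assume "x \<in> D4"
  then obtain z :: "4 \<Rightarrow> int" where z: "x = (\<chi> i. real_of_int (z i))" "(\<Sum>i\<in>UNIV. z i) mod 2 = 0"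
    unfolding D4_def by auto
  have "x = vec4 (of_int (z 1)) (of_int (z 2)) (of_int (z 3)) (of_int (z 4))"
    by (rule vec4_eqI) (simp_all add: z(1))
  moreover have "even (z 1 + z 2 + z 3 + z 4)" using z(2) unfolding sum_4 by presburger
  ultimately show "\<exists>a b c d. x = vec4 (of_int a) (of_int b) (of_int c) (of_int d) \<and> even (a + b + c + d)" by blast
next
  assume "\<exists>a b c d. x = vec4 (of_int a) (of_int b) (of_int c) (of_int d) \<and> even (a + b + c + d)"
  then obtain a b c d where x: "x = vec4 (of_int a) (of_int b) (of_int c) (of_int d)" "even (a + b + c + d)" by blast
  define z where "z i = vec4 a b c d $ i" for i
  have "x = (\<chi> i. real_of_int (z i))" by (rule vec4_eqI) (simp_all add: x z_def)
  moreover have "sum z UNIV mod 2 = 0"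
    using x(2) unfolding sum_4 z_def vec4_nth by presburger
  ultimately show "x \<in> D4" unfolding D4_def by auto
qed

lemma vec4_of_int_in_D4: "even (a + b + c + d) \<Longrightarrow> vec4 (of_int a) (of_int b) (of_int c) (of_int d) \<in> D4"
  unfolding D4_iff by blast

lemma D4_coord_swap: "x \<in> D4 \<Longrightarrow> coord_swap i j x \<in> D4"
proof -
  assume "x \<in> D4"
  then obtain z :: "4 \<Rightarrow> int" where z: "x = (\<chi> i. real_of_int (z i))" "(\<Sum>i\<in>UNIV. z i) mod 2 = 0"
    unfolding D4_def by auto
  have "(\<Sum>k\<in>UNIV. z (Transposition.transpose i j k)) = (\<Sum>k\<in>UNIV. z k)"
    by (rule sum.reindex_bij_witness[of _ "Transposition.transpose i j" "Transposition.transpose i j"]) auto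
  thus ?thesis using z unfolding D4_def
    by (intro CollectI exI[of _ "\<lambda>k. z (Transposition.transpose i j k)"]) (simp add: coord_swap_def vec_eq_iff)
qed

lemma D4_coord_flip: "x \<in> D4 \<Longrightarrow> coord_flip i x \<in> D4"
proof -
  assume "x \<in> D4"
  then obtain z :: "4 \<Rightarrow> int" where z: "x = (\<chi> i. real_of_int (z i))" "(\<Sum>i\<in>UNIV. z i) mod 2 = 0"
    unfolding D4_def by auto
  define w where "w k = (if k = i then - z k else z k)" for k
  have "sum w (UNIV - {i}) = sum z (UNIV - {i})" by (rule sum.cong) (auto simp: w_def)
  hence "sum w UNIV = sum z UNIV - 2 * z i"
    using sum.remove[of UNIV i w] sum.remove[of UNIV i z] by (simp add: w_def)
  hence "sum w UNIV mod 2 = 0" using z(2) by presburger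
  thus ?thesis using z unfolding D4_def
    by (intro CollectI exI[of _ w]) (simp add: coord_flip_def vec_eq_iff w_def)
qed

lemma dual_lattice_involution:
  assumes "\<And>x. x \<in> L \<Longrightarrow> g x \<in> L" "\<And>x y. g x \<bullet> y = x \<bullet> g y"
  shows "y \<in> dual_lattice L \<Longrightarrow> g y \<in> dual_lattice L"
  using assms by (auto simp: dual_lattice_def)

text \<open>A self-adjoint map preserving \<open>D4\<close> preserves its dual, and homogeneity
  extends this to the multiple by \<open>sqrt 2\<close>. This covers flips and swaps;
  \<open>tau\<close> exchanges the two lattices and is treated separately.\<close>

lemma D4_union_involution:
  assumes "\<And>x. x \<in> D4 \<Longrightarrow> g x \<in> D4" "\<And>x y. g x \<bullet> y = x \<bullet> g y"
    "\<And>c x. g (c *\<^sub>R x) = c *\<^sub>R g x"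
  shows "y \<in> D4_union \<Longrightarrow> g y \<in> D4_union"
  using assms dual_lattice_involution[of D4 g]
  by (auto simp: D4_union_def D4'_def)

text \<open>Pair y with the vectors e1 + e2, e1 - e2, e3 + e4, e3 - e4 of \<open>D4\<close>. The
  parity comes from pairing with e1 + e3, since a + b + c + d is twice y1 + y3. These four integers
  are the coordinates of \<open>tau (sqrt 2 *\<^sub>R y)\<close>.\<close>

lemma dual_D4_coordinates:
  assumes "y \<in> dual_lattice D4"
  obtains a b c d where "y $ 1 + y $ 2 = of_int a" "y $ 1 - y $ 2 = of_int b"
    "y $ 3 + y $ 4 = of_int c" "y $ 3 - y $ 4 = of_int d" "even (a + b + c + d)"
proof -
  have "y \<bullet> vec4 1 1 0 0 \<in> \<int>" "y \<bullet> vec4 1 (-1) 0 0 \<in> \<int>" "y \<bullet> vec4 0 0 1 1 \<in> \<int>"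
    "y \<bullet> vec4 0 0 1 (-1) \<in> \<int>" "y \<bullet> vec4 1 0 1 0 \<in> \<int>"
  proof -
    have "vec4 1 1 0 0 \<in> D4" "vec4 1 (-1) 0 0 \<in> D4" "vec4 0 0 1 1 \<in> D4"
      "vec4 0 0 1 (-1) \<in> D4" "vec4 1 0 1 0 \<in> D4"
      using vec4_of_int_in_D4[of 1 1 0 0] vec4_of_int_in_D4[of 1 "-1" 0 0] vec4_of_int_in_D4[of 0 0 1 1]
        vec4_of_int_in_D4[of 0 0 1 "-1"] vec4_of_int_in_D4[of 1 0 1 0] by simp_all
    thus "y \<bullet> vec4 1 1 0 0 \<in> \<int>" "y \<bullet> vec4 1 (-1) 0 0 \<in> \<int>" "y \<bullet> vec4 0 0 1 1 \<in> \<int>"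
    "y \<bullet> vec4 0 0 1 (-1) \<in> \<int>" "y \<bullet> vec4 1 0 1 0 \<in> \<int>"
      using assms unfolding dual_lattice_def by blast+
  qed
  then obtain a b c d e where *: "y $ 1 + y $ 2 = of_int a" "y $ 1 - y $ 2 = of_int b"
    "y $ 3 + y $ 4 = of_int c" "y $ 3 - y $ 4 = of_int d" "y $ 1 + y $ 3 = of_int e"
    by (auto simp: inner_4 elim!: Ints_cases)
  hence "real_of_int (a + b + c + d) = real_of_int (2 * e)" by simp
  hence "a + b + c + d = 2 * e" by (simp only: of_int_eq_iff)
  thus ?thesis using that[OF *(1-4)] by (metis dvd_triv_left)
qed

lemma tau_scaled_dual: "y \<in> dual_lattice D4 \<Longrightarrow> tau (sqrt 2 *\<^sub>R y) \<in> D4"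
proof -
  assume "y \<in> dual_lattice D4"
  then obtain a b c d where *: "y $ 1 + y $ 2 = of_int a" "y $ 1 - y $ 2 = of_int b"
    "y $ 3 + y $ 4 = of_int c" "y $ 3 - y $ 4 = of_int d" "even (a + b + c + d)"
    by (rule dual_D4_coordinates)
  have "tau (sqrt 2 *\<^sub>R y) = vec4 (of_int a) (of_int b) (of_int c) (of_int d)"
    by (rule vec4_eqI) (simp_all add: *(1-4)[symmetric] field_simps)
  thus ?thesis unfolding D4_iff using *(5) by blast
qed

lemma tau_D4: "x \<in> D4 \<Longrightarrow> tau x \<in> D4'"
proof -
  assume "x \<in> D4"
  then obtain a b c d where x: "x = vec4 (of_int a) (of_int b) (of_int c) (of_int d)" "even (a + b + c + d)"
    unfolding D4_iff by blast
  define y where "y = (1 / sqrt 2) *\<^sub>R tau x"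
  have "y \<bullet> z \<in> \<int>" if zD: "z \<in> D4" for z
  proof -
    obtain p q r s where z: "z = vec4 (of_int p) (of_int q) (of_int r) (of_int s)" "even (p + q + r + s)"
      using zD unfolding D4_iff by blast
    \<comment> \<open>Modulo 2 the sum is (a + b)(p + q) + (c + d)(r + s). As a + b and c + d have
      the same parity, it is congruent to (a + b)(p + q + r + s), which is even.\<close>
    have "even ((a + b) * p + (a - b) * q + (c + d) * r + (c - d) * s)"
      using x(2) z(2) by (auto simp: even_add even_diff)
    then obtain k where k: "(a + b) * p + (a - b) * q + (c + d) * r + (c - d) * s = 2 * k" by (elim evenE)
    have "2 * (y \<bullet> z) = real_of_int ((a + b) * p + (a - b) * q + (c + d) * r + (c - d) * s)"
      by (simp add: y_def inner_4 x z field_simps)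
    hence "y \<bullet> z = of_int k" unfolding k by simp
    thus ?thesis by simp
  qed
  hence "y \<in> dual_lattice D4" by (simp add: dual_lattice_def)
  moreover have "tau x = sqrt 2 *\<^sub>R y" by (simp add: y_def)
  ultimately show ?thesis unfolding D4'_def by blast
qed

lemma D4'_eq_tau_image: "D4' = tau ` D4"
proof
  show "tau ` D4 \<subseteq> D4'" using tau_D4 by blast
  show "D4' \<subseteq> tau ` D4"
  proof
    fix x assume "x \<in> D4'"
    hence "tau x \<in> D4" unfolding D4'_def using tau_scaled_dual by blast
    moreover have "x = tau (tau x)" by simp
    ultimately show "x \<in> tau ` D4" by blast
  qed
qed

lemma shell_involution:
  assumes "\<And>x. x \<in> D4_union \<Longrightarrow> g x \<in> D4_union" "\<And>x y. g x \<bullet> y = x \<bullet> g y" "\<And>x. g (g x) = x"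
    and "x \<in> shell m"
  shows "g x \<in> shell m"
  using assms by (simp add: shell_def)

lemma shell_tau: "x \<in> shell m \<Longrightarrow> tau x \<in> shell m"
  by (rule shell_involution) (auto simp: D4_union_def D4'_eq_tau_image tau_inner)

lemma shell_coord_flip: "x \<in> shell m \<Longrightarrow> coord_flip i x \<in> shell m"
  by (rule shell_involution[OF D4_union_involution])
     (auto simp: D4_coord_flip coord_flip_inner linear_cmul[OF linear_coord_flip])

lemma shell_coord_swap: "x \<in> shell m \<Longrightarrow> coord_swap i j x \<in> shell m"
  by (rule shell_involution[OF D4_union_involution])
     (auto simp: D4_coord_swap coord_swap_inner coord_swap_scaleR)

section \<open>Integer points of a given norm\<close>

definition int_points :: "int \<Rightarrow> (int \<times> int \<times> int \<times> int) set" where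
  "int_points m = {(a, b, c, d). a\<^sup>2 + b\<^sup>2 + c\<^sup>2 + d\<^sup>2 = m}"

definition real_vec :: "int \<times> int \<times> int \<times> int \<Rightarrow> real^4" where
  "real_vec = (\<lambda>(a, b, c, d). vec4 (of_int a) (of_int b) (of_int c) (of_int d))"

lemma inj_real_vec: "inj real_vec"
proof (rule injI)
  fix x y :: "int \<times> int \<times> int \<times> int"
  assume eq: "real_vec x = real_vec y"
  obtain a b c d a' b' c' d' where xy: "x = (a, b, c, d)" "y = (a', b', c', d')" by (metis prod_cases4)
  have "real_vec x $ i = real_vec y $ i" for i using eq by simp
  from this[of 1] this[of 2] this[of 3] this[of 4] show "x = y" by (simp add: real_vec_def xy)
qed

lemma inj_tau: "inj tau"
  by (metis injI tau_tau)

lemma inner_real_vec: "real_vec (a, b, c, d) \<bullet> real_vec (a, b, c, d) = of_int (a\<^sup>2 + b\<^sup>2 + c\<^sup>2 + d\<^sup>2)"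
  by (simp add: real_vec_def inner_4 power2_eq_square)

text \<open>A square has the parity of its root, so for an even norm the parity condition defining
  \<open>D4\<close> holds for every integer vector.\<close>

lemma D4_shell: "{x \<in> D4. x \<bullet> x = of_int (2 * m)} = real_vec ` int_points (2 * m)"
proof (intro equalityI subsetI)
  fix x assume "x \<in> {x \<in> D4. x \<bullet> x = of_int (2 * m)}"
  then obtain a b c d where x: "x = real_vec (a, b, c, d)" "x \<bullet> x = of_int (2 * m)"
    unfolding D4_iff real_vec_def by auto
  hence "(a, b, c, d) \<in> int_points (2 * m)"
    unfolding x(1) inner_real_vec by (simp only: of_int_eq_iff int_points_def) simp
  thus "x \<in> real_vec ` int_points (2 * m)" using x by blast
next
  fix x assume "x \<in> real_vec ` int_points (2 * m)"
  then obtain a b c d where x: "x = real_vec (a, b, c, d)" "a\<^sup>2 + b\<^sup>2 + c\<^sup>2 + d\<^sup>2 = 2 * m"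
    by (auto simp: int_points_def)
  have "even (a\<^sup>2 + b\<^sup>2 + c\<^sup>2 + d\<^sup>2)" unfolding x(2) by simp
  hence "even (a + b + c + d)" by (simp add: even_add)
  moreover have "x \<bullet> x = of_int (2 * m)" unfolding x(1) inner_real_vec x(2) ..
  ultimately show "x \<in> {x \<in> D4. x \<bullet> x = of_int (2 * m)}"
    using x(1) unfolding D4_iff real_vec_def by auto
qed

lemma shell_eq:
  "shell (of_int (2 * m)) = real_vec ` int_points (2 * m) \<union> tau ` real_vec ` int_points (2 * m)"
proof -
  have "shell (of_int (2 * m)) = {x \<in> D4. x \<bullet> x = of_int (2 * m)} \<union> tau ` {x \<in> D4. x \<bullet> x = of_int (2 * m)}"
    by (auto simp: shell_def D4_union_def D4'_eq_tau_image tau_inner)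
  thus ?thesis by (simp only: D4_shell)
qed

lemma finite_int_points: "finite (int_points m)"
proof -
  have sq: "\<bar>a\<bar> \<le> a\<^sup>2" for a :: int
  proof (cases "a = 0")
    case False
    hence "\<bar>a\<bar> * 1 \<le> \<bar>a\<bar> * \<bar>a\<bar>" by (intro mult_left_mono) auto
    thus ?thesis by (simp add: power2_eq_square)
  qed simp
  have "int_points m \<subseteq> {-m..m} \<times> {-m..m} \<times> {-m..m} \<times> {-m..m}"
  proof
    fix z assume "z \<in> int_points m"
    then obtain a b c d where z: "z = (a, b, c, d)" "a\<^sup>2 + b\<^sup>2 + c\<^sup>2 + d\<^sup>2 = m" by (auto simp: int_points_def)
    moreover have "a\<^sup>2 \<ge> 0" "b\<^sup>2 \<ge> 0" "c\<^sup>2 \<ge> 0" "d\<^sup>2 \<ge> 0" by simp_all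
    ultimately have "\<bar>a\<bar> \<le> m" "\<bar>b\<bar> \<le> m" "\<bar>c\<bar> \<le> m" "\<bar>d\<bar> \<le> m"
      using sq[of a] sq[of b] sq[of c] sq[of d] by linarith+
    thus "z \<in> {-m..m} \<times> {-m..m} \<times> {-m..m} \<times> {-m..m}" using z by auto
  qed
  thus ?thesis by (rule finite_subset) simp
qed

lemma int_points_nonempty: "m \<ge> 0 \<Longrightarrow> int_points m \<noteq> {}"
proof -
  assume "m \<ge> 0"
  hence "sum4sq m" using lagrange_four_squares[of "nat m"] by simp
  thus ?thesis by (auto simp: sum4sq_def int_points_def)
qed

lemma finite_shell: "finite (shell (of_int (2 * m)))"
  unfolding shell_eq using finite_int_points by simp

lemma shell_nonempty: "m \<ge> 0 \<Longrightarrow> shell (of_int (2 * m)) \<noteq> {}"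
  unfolding shell_eq using int_points_nonempty by simp

lemma shell_subset_sqsphere: "shell m \<subseteq> sqsphere m"
  by (auto simp: shell_def sqsphere_def)


section \<open>The 7-designs\<close>

lemma sum_shell_involution:
  fixes F :: "real^4 \<Rightarrow> real"
  assumes "\<And>x. x \<in> shell m \<Longrightarrow> g x \<in> shell m" "\<And>x. g (g x) = x"
  shows "(\<Sum>x\<in>shell m. F (g x)) = (\<Sum>x\<in>shell m. F x)"
  by (rule sum.reindex_bij_witness[of _ g g]) (use assms in auto)

lemma sum_shell_monomial_odd:
  assumes "odd (\<alpha> i)"
  shows "(\<Sum>x\<in>shell m. monomial \<alpha> x) = 0"
proof -
  have "(\<Sum>x\<in>shell m. monomial \<alpha> (coord_flip i x)) = (\<Sum>x\<in>shell m. monomial \<alpha> x)"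
    by (rule sum_shell_involution) (auto intro: shell_coord_flip)
  thus ?thesis using assms by (simp add: monomial_coord_flip sum_negf)
qed

definition even_monomial :: "nat \<Rightarrow> nat \<Rightarrow> nat \<Rightarrow> nat \<Rightarrow> real^4 \<Rightarrow> real" where
  "even_monomial p q r s x = (x $ 1) ^ (2 * p) * (x $ 2) ^ (2 * q) * (x $ 3) ^ (2 * r) * (x $ 4) ^ (2 * s)"

lemma even_monomial_tau:
  "even_monomial p q r s (tau x) = ((x $ 1 + x $ 2) ^ (2 * p) * (x $ 1 - x $ 2) ^ (2 * q) *
     (x $ 3 + x $ 4) ^ (2 * r) * (x $ 3 - x $ 4) ^ (2 * s)) / 2 ^ (p + q + r + s)"
proof -
  have "(u / sqrt 2) ^ (2 * n) = u ^ (2 * n) / 2 ^ n" for u n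
    by (simp add: power_divide power_mult)
  thus ?thesis by (simp add: even_monomial_def power_add)
qed

lemma prod_4: "prod f (UNIV :: 4 set) = f 1 * f 2 * f 3 * f 4"
  unfolding UNIV_4 by (simp add: ac_simps)

lemma monomial_eq_even_monomial:
  "monomial (\<lambda>i. 2 * \<beta> i) x = even_monomial (\<beta> 1) (\<beta> 2) (\<beta> 3) (\<beta> 4) x"
  by (simp add: monomial_def even_monomial_def prod_4)

definition shell_moment :: "real \<Rightarrow> nat \<Rightarrow> nat \<Rightarrow> nat \<Rightarrow> nat \<Rightarrow> real" where
  "shell_moment m p q r s = (\<Sum>x\<in>shell m. even_monomial p q r s x)"

lemma shell_moment_swap:
  "shell_moment m q p r s = shell_moment m p q r s"
  "shell_moment m p r q s = shell_moment m p q r s"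
  "shell_moment m p q s r = shell_moment m p q r s"
proof -
  have inv: "(\<Sum>x\<in>shell m. F (coord_swap i j x)) = (\<Sum>x\<in>shell m. F x)" for F :: "real^4 \<Rightarrow> real" and i j
    by (rule sum_shell_involution) (auto intro: shell_coord_swap)
  have "even_monomial q p r s (coord_swap 1 2 x) = even_monomial p q r s x"
    "even_monomial p r q s (coord_swap 2 3 x) = even_monomial p q r s x"
    "even_monomial p q s r (coord_swap 3 4 x) = even_monomial p q r s x" for x
    by (simp_all add: even_monomial_def coord_swap_def Transposition.transpose_def mult_ac)
  thus "shell_moment m q p r s = shell_moment m p q r s"
    "shell_moment m p r q s = shell_moment m p q r s"
    "shell_moment m p q s r = shell_moment m p q r s"
    unfolding shell_moment_def by (metis (no_types, lifting) inv sum.cong)+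
qed

text \<open>Insertion sort by adjacent transpositions, which generate all permutations of the four
  exponents. A claim about moments then has to be checked only for decreasing exponents.\<close>

lemma symmetric4_wlog:
  fixes P :: "nat \<Rightarrow> nat \<Rightarrow> nat \<Rightarrow> nat \<Rightarrow> bool"
  assumes 12: "\<And>p q r s. P p q r s \<Longrightarrow> P q p r s"
    and 23: "\<And>p q r s. P p q r s \<Longrightarrow> P p r q s"
    and 34: "\<And>p q r s. P p q r s \<Longrightarrow> P p q s r"
    and sorted: "\<And>p q r s. q \<le> p \<Longrightarrow> r \<le> q \<Longrightarrow> s \<le> r \<Longrightarrow> p + q + r + s = k \<Longrightarrow> P p q r s"
    and "p + q + r + s = k"
  shows "P p q r s"
proof -
  have step1: "P p q r s" if "r \<le> q" "s \<le> r" "p + q + r + s = k" for p q r s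
  proof -
    consider "q \<le> p" | "p \<le> q" "r \<le> p" | "p \<le> r" "s \<le> p" | "p \<le> s" by linarith
    thus ?thesis
    proof cases
      case 1 thus ?thesis using that by (intro sorted)
    next
      case 2 thus ?thesis using that by (intro 12[OF sorted]) auto
    next
      case 3 thus ?thesis using that by (intro 12[OF 23[OF sorted]]) auto
    next
      case 4 thus ?thesis using that by (intro 12[OF 23[OF 34[OF sorted]]]) auto
    qed
  qed
  have step2: "P p q r s" if "s \<le> r" "p + q + r + s = k" for p q r s
  proof -
    consider "r \<le> q" | "q \<le> r" "s \<le> q" | "q \<le> s" by linarith
    thus ?thesis
    proof cases
      case 1 thus ?thesis using that by (intro step1) auto
    next
      case 2 thus ?thesis using that by (intro 23[OF step1]) auto
    next
      case 3 thus ?thesis using that by (intro 23[OF 34[OF step1]]) auto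
    qed
  qed
  show ?thesis
  proof (cases "s \<le> r")
    case True thus ?thesis using assms(5) by (rule step2)
  next
    case False thus ?thesis using assms(5) by (intro 34[OF step2]) auto
  qed
qed

text \<open>By permutations only the moments A, B, C of types (3,0,0,0), (2,1,0,0), (1,1,1,0)
  remain. Invariance under \<open>tau\<close> gives 2A = A/2 + 15B/2 and 2C = B - C, so A : B : C =
  15 : 3 : 1, the ratios of the products of double factorials.\<close>

lemma shell_moment_degree_6:
  "shell_moment m 3 0 0 0 = 15 * shell_moment m 1 1 1 0"
  "shell_moment m 2 1 0 0 = 3 * shell_moment m 1 1 1 0"
proof -
  let ?A = "shell_moment m 3 0 0 0" and ?B = "shell_moment m 2 1 0 0" and ?C = "shell_moment m 1 1 1 0"
  have A: "shell_moment m 0 3 0 0 = ?A"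
    by (rule shell_moment_swap)
  have B: "shell_moment m 1 2 0 0 = ?B" "shell_moment m 2 0 1 0 = ?B" "shell_moment m 2 0 0 1 = ?B"
    "shell_moment m 0 2 1 0 = ?B" "shell_moment m 0 2 0 1 = ?B"
    by (metis shell_moment_swap)+
  have C: "shell_moment m 1 1 0 1 = ?C" by (rule shell_moment_swap)
  have inv: "(\<Sum>x\<in>shell m. F (tau x)) = (\<Sum>x\<in>shell m. F x)" for F :: "real^4 \<Rightarrow> real"
    by (rule sum_shell_involution) (auto intro: shell_tau)
  \<comment> \<open>The symmetric sum of the sixth powers of the first two coordinates is used
    because the odd terms of the two binomial expansions cancel after applying
    \<open>tau\<close>.\<close>
  have "?A + shell_moment m 0 3 0 0 = (\<Sum>x\<in>shell m. even_monomial 3 0 0 0 x + even_monomial 0 3 0 0 x)"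
    by (simp add: shell_moment_def sum.distrib)
  also have "\<dots> = (\<Sum>x\<in>shell m. even_monomial 3 0 0 0 (tau x) + even_monomial 0 3 0 0 (tau x))"
    by (rule inv[symmetric])
  also have "\<dots> = (\<Sum>x\<in>shell m. 1/4 * even_monomial 3 0 0 0 x + 15/4 * even_monomial 2 1 0 0 x
      + 15/4 * even_monomial 1 2 0 0 x + 1/4 * even_monomial 0 3 0 0 x)"
    by (rule sum.cong[OF refl], unfold even_monomial_tau, unfold even_monomial_def)
      (simp add: eval_nat_numeral field_simps)
  also have "\<dots> = 1/4 * ?A + 15/4 * ?B + 15/4 * shell_moment m 1 2 0 0 + 1/4 * shell_moment m 0 3 0 0"
    unfolding shell_moment_def sum.distrib sum_distrib_left ..
  finally have AB: "?A = 5 * ?B" unfolding A B by simp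
  \<comment> \<open>Here \<open>tau\<close> keeps the sum of the squares of coordinates 3 and 4 and
    turns the product of the squares of coordinates 1 and 2 into a quarter of the squared difference
    of their squares.\<close>
  have "?C + shell_moment m 1 1 0 1 = (\<Sum>x\<in>shell m. even_monomial 1 1 1 0 x + even_monomial 1 1 0 1 x)"
    by (simp add: shell_moment_def sum.distrib)
  also have "\<dots> = (\<Sum>x\<in>shell m. even_monomial 1 1 1 0 (tau x) + even_monomial 1 1 0 1 (tau x))"
    by (rule inv[symmetric])
  also have "\<dots> = (\<Sum>x\<in>shell m. 1/4 * even_monomial 2 0 1 0 x + 1/4 * even_monomial 2 0 0 1 x
      + 1/4 * even_monomial 0 2 1 0 x + 1/4 * even_monomial 0 2 0 1 x
      - 1/2 * even_monomial 1 1 1 0 x - 1/2 * even_monomial 1 1 0 1 x)"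
    by (rule sum.cong[OF refl], unfold even_monomial_tau, unfold even_monomial_def)
      (simp add: eval_nat_numeral field_simps)
  also have "\<dots> = 1/4 * shell_moment m 2 0 1 0 + 1/4 * shell_moment m 2 0 0 1 + 1/4 * shell_moment m 0 2 1 0
      + 1/4 * shell_moment m 0 2 0 1 - 1/2 * ?C - 1/2 * shell_moment m 1 1 0 1"
    unfolding shell_moment_def sum.distrib sum_subtractf sum_distrib_left ..
  finally have BC: "?B = 3 * ?C" unfolding B C by simp
  show "?B = 3 * ?C" by (rule BC)
  show "?A = 15 * ?C" using AB BC by simp
qed

lemma odd_fact_numeral [simp]:
  "odd_fact 1 = 1" "odd_fact (Suc 0) = 1" "odd_fact 2 = 3" "odd_fact 3 = 15"
proof -
  show 1: "odd_fact (Suc 0) = 1" "odd_fact 1 = 1" using odd_fact_Suc[of 0] by simp_all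
  show 2: "odd_fact 2 = 3" using odd_fact_Suc[of 1] 1 by (simp add: eval_nat_numeral)
  show "odd_fact 3 = 15" using odd_fact_Suc[of 2] 2 by (simp add: eval_nat_numeral)
qed

lemma shell_moment_6:
  assumes "p + q + r + s = 3"
  shows "shell_moment m p q r s
    = shell_moment m 1 1 1 0 * (odd_fact p * odd_fact q * odd_fact r * odd_fact s)"
proof (rule symmetric4_wlog[where k = 3 and P = "\<lambda>p q r s. shell_moment m p q r s
    = shell_moment m 1 1 1 0 * (odd_fact p * odd_fact q * odd_fact r * odd_fact s)"])
  fix p q r s :: nat
  assume le: "q \<le> p" "r \<le> q" "s \<le> r" and sum: "p + q + r + s = 3"
  have s0: "s = 0" and r1: "r = 0 \<or> r = 1 \<and> q = 1" using le sum by linarith+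
  have "p = 3 \<and> q = 0 \<and> r = 0 \<and> s = 0 \<or> p = 2 \<and> q = 1 \<and> r = 0 \<and> s = 0 \<or> p = 1 \<and> q = 1 \<and> r = 1 \<and> s = 0"
    using r1 le(1) sum by (elim disjE) (simp_all add: s0, linarith)
  thus "shell_moment m p q r s
    = shell_moment m 1 1 1 0 * (odd_fact p * odd_fact q * odd_fact r * odd_fact s)"
    using shell_moment_degree_6[of m] by auto
qed (use assms in \<open>simp_all add: shell_moment_swap mult_ac\<close>)

theorem spherical_design_shell:
  assumes "m \<ge> 1"
  shows "spherical_design 7 (2 * real m) (shell (2 * real m))"
proof -
  have e: "2 * real m = of_int (2 * int m)" by simp
  let ?S = "shell (2 * real m)"
  \<comment> \<open>On an empty shell the constant polynomial 1 would already be integrated wrongly;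
    here the four square theorem enters.\<close>
  have fin: "finite ?S" and ne: "?S \<noteq> {}"
    unfolding e by (simp_all only: finite_shell) (rule shell_nonempty, simp)
  show ?thesis
    unfolding spherical_design_def
  proof (rule cubature_formula_criterion[where k = 3 and \<kappa> = "shell_moment (2 * real m) 1 1 1 0 / card ?S"])
    show "2 * real m > 0" using assms by simp
    show "?S \<subseteq> sqsphere (2 * real m)" by (rule shell_subset_sqsphere)
    show "0 < 1 / real (card ?S)" using fin ne by (simp add: card_gt_0_iff)
    show "(\<Sum>x\<in>?S. 1 / real (card ?S)) = 1" using fin ne by simp
    show "(\<Sum>x\<in>?S. 1 / real (card ?S) * monomial \<alpha> x) = 0" if "odd (\<alpha> i)" for \<alpha> i
      unfolding sum_distrib_left[symmetric] sum_shell_monomial_odd[of \<alpha>, OF that] by simp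
    show "(\<Sum>x\<in>?S. 1 / real (card ?S) * monomial (\<lambda>i. 2 * \<beta> i) x)
        = shell_moment (2 * real m) 1 1 1 0 / card ?S * (\<Prod>i\<in>UNIV. odd_fact (\<beta> i))"
      if "sum \<beta> UNIV = 3" for \<beta>
      unfolding sum_distrib_left[symmetric] monomial_eq_even_monomial shell_moment_def[symmetric]
      using shell_moment_6[of "\<beta> 1" "\<beta> 2" "\<beta> 3" "\<beta> 4"] that by (simp add: sum_4 prod_4)
  qed (simp_all add: fin)
qed


section \<open>Moments of the shells of norm 2, 6 and 10\<close>

text \<open>If a were nonzero, the multiplicity of p would be odd on the left and even on the right.
  With p = 2 this separates the two halves of a shell, with p = 3 and p = 5 the unit shells.\<close>

lemma prime_times_square_eq_square:
  fixes p u v a b :: int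
  assumes p: "prime p" and u: "\<not> p dvd u" and v: "\<not> p dvd v" and eq: "p * u * a\<^sup>2 = v * b\<^sup>2"
  shows "a = 0"
proof (rule ccontr)
  assume a: "a \<noteq> 0"
  have nz: "p \<noteq> 0" "u \<noteq> 0" "v \<noteq> 0" using p u v by auto
  hence b: "b \<noteq> 0" using a eq by auto
  have pe: "prime_elem p" using p by (rule prime_imp_prime_elem)
  have "multiplicity p (p * u * a\<^sup>2) = Suc (2 * multiplicity p a)"
    using nz a pe u p
    by (simp add: prime_elem_multiplicity_mult_distrib prime_elem_multiplicity_power_distrib
        not_dvd_imp_multiplicity_0)
  moreover have "multiplicity p (v * b\<^sup>2) = 2 * multiplicity p b"
    using nz b pe v
    by (simp add: prime_elem_multiplicity_mult_distrib prime_elem_multiplicity_power_distrib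
        not_dvd_imp_multiplicity_0)
  ultimately have "Suc (2 * multiplicity p a) = 2 * multiplicity p b" using eq by simp
  thus False by presburger
qed

lemma real_vec_coordinate: "\<exists>a. real_vec z $ i = of_int a"
proof -
  obtain a b c d where "z = (a, b, c, d)" by (metis prod_cases4)
  thus ?thesis using exhaust_4[of i] by (auto simp: real_vec_def)
qed

lemma tau_real_vec_coordinate: "\<exists>a. tau (real_vec z) $ i = of_int a / sqrt 2"
proof -
  obtain a b c d where z: "z = (a, b, c, d)" by (metis prod_cases4)
  have "tau (real_vec z) $ 1 = of_int (a + b) / sqrt 2" "tau (real_vec z) $ 2 = of_int (a - b) / sqrt 2"
    "tau (real_vec z) $ 3 = of_int (c + d) / sqrt 2" "tau (real_vec z) $ 4 = of_int (c - d) / sqrt 2"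
    by (simp_all add: z real_vec_def)
  thus ?thesis using exhaust_4[of i] by metis
qed

lemma real_vec_eq_tau_imp_0:
  assumes "real_vec z = tau (real_vec z')"
  shows "real_vec z = 0"
proof -
  have "real_vec z $ i = 0" for i
  proof -
    obtain a b where a: "real_vec z $ i = of_int a" and b: "tau (real_vec z') $ i = of_int b / sqrt 2"
      using real_vec_coordinate tau_real_vec_coordinate by metis
    have "of_int a * sqrt 2 = real_of_int b" using a b assms by (simp add: field_simps)
    hence "(of_int a * sqrt 2)\<^sup>2 = (real_of_int b)\<^sup>2" by simp
    hence "real_of_int (2 * 1 * a\<^sup>2) = real_of_int (1 * b\<^sup>2)" by (simp add: power_mult_distrib mult.commute)
    hence "2 * 1 * a\<^sup>2 = 1 * b\<^sup>2" by (simp only: of_int_eq_iff)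
    hence "a = 0" by (intro prime_times_square_eq_square[of 2 1 1 a b]) simp_all
    thus ?thesis using a by simp
  qed
  thus ?thesis by (simp add: vec_eq_iff)
qed

text \<open>Integer coordinates meet integers divided by \<open>sqrt 2\<close> only in 0. Sums over
  a shell therefore split into two sums over the same integer points, and the size doubles.\<close>

lemma disjoint_shell_halves:
  assumes "m > 0"
  shows "real_vec ` int_points m \<inter> tau ` real_vec ` int_points m = {}"
proof -
  have "real_vec z \<noteq> tau (real_vec z')" if z: "z \<in> int_points m" for z z'
  proof
    assume "real_vec z = tau (real_vec z')"
    from real_vec_eq_tau_imp_0[OF this] have "real_vec z \<bullet> real_vec z = 0" by simp
    moreover have "real_vec z \<bullet> real_vec z = of_int m"
      using z by (cases z) (simp only: int_points_def inner_real_vec mem_Collect_eq prod.case)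
    ultimately show False using assms by simp
  qed
  thus ?thesis by blast
qed

lemma sum_shell:
  fixes F :: "real^4 \<Rightarrow> real"
  assumes "m > 0"
  shows "(\<Sum>x\<in>shell (of_int (2 * m)). F x)
    = (\<Sum>z\<in>int_points (2 * m). F (real_vec z) + F (tau (real_vec z)))"
proof -
  let ?A = "real_vec ` int_points (2 * m)"
  have "(\<Sum>x\<in>shell (of_int (2 * m)). F x) = (\<Sum>x\<in>?A. F x) + (\<Sum>x\<in>tau ` ?A. F x)"
    unfolding shell_eq using finite_int_points disjoint_shell_halves assms
    by (intro sum.union_disjoint) auto
  also have "(\<Sum>x\<in>tau ` ?A. F x) = (\<Sum>x\<in>?A. F (tau x))"
    by (subst sum.reindex) (auto intro: inj_on_subset[OF inj_tau])
  also have "(\<Sum>x\<in>?A. F x) + (\<Sum>x\<in>?A. F (tau x)) = (\<Sum>x\<in>?A. F x + F (tau x))"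
    by (rule sum.distrib[symmetric])
  also have "\<dots> = (\<Sum>z\<in>int_points (2 * m). F (real_vec z) + F (tau (real_vec z)))"
    by (subst sum.reindex) (auto intro: inj_on_subset[OF inj_real_vec])
  finally show ?thesis .
qed

lemma card_shell:
  assumes "m > 0"
  shows "card (shell (of_int (2 * m))) = 2 * card (int_points (2 * m))"
proof -
  have "real (card (shell (of_int (2 * m)))) = (\<Sum>x\<in>shell (of_int (2 * m)). 1)" by simp
  also have "\<dots> = real (2 * card (int_points (2 * m)))" unfolding sum_shell[OF assms] by simp
  finally show ?thesis by (simp only: of_nat_eq_iff)
qed

section \<open>Enumeration of short integer vectors and their integer moments\<close>

definition small_ints :: "int list" where
  "small_ints = [-3, -2, -1, 0, 1, 2, 3]"

text \<open>An executable form of \<open>int_points\<close>. It is complete for norms below 16,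
  which force every coordinate to have absolute value at most 3.\<close>

definition int_point_list :: "int \<Rightarrow> (int \<times> int \<times> int \<times> int) list" where
  "int_point_list m = [(a, b, c, d). a \<leftarrow> small_ints, b \<leftarrow> small_ints, c \<leftarrow> small_ints,
     d \<leftarrow> small_ints, a * a + b * b + c * c + d * d = m]"

lemma distinct_concat_map:
  assumes "distinct xs" "\<And>x. distinct (f x)" "\<And>x y. x \<noteq> y \<Longrightarrow> set (f x) \<inter> set (f y) = {}"
  shows "distinct (concat (map f xs))"
  using assms(1)
proof (induction xs)
  case (Cons x xs)
  hence "set (f x) \<inter> set (f y) = {}" if "y \<in> set xs" for y
    using that by (intro assms(3)) auto
  thus ?case using Cons assms(2) by auto
qed simp

lemma distinct_int_point_list: "distinct (int_point_list m)"
proof -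
  have "distinct small_ints" by (simp add: small_ints_def)
  thus ?thesis unfolding int_point_list_def by (intro distinct_concat_map) (auto split: if_splits)
qed

lemma set_int_point_list:
  assumes "m < 16"
  shows "set (int_point_list m) = int_points m"
proof -
  have small: "x \<in> set small_ints" if "x\<^sup>2 < 16" for x :: int
  proof -
    have "\<bar>x\<bar> < 4" using that power2_less_imp_less[of "\<bar>x\<bar>" 4] by simp
    thus ?thesis by (auto simp: small_ints_def)
  qed
  have "a \<in> set small_ints \<and> b \<in> set small_ints \<and> c \<in> set small_ints \<and> d \<in> set small_ints"
    if "a\<^sup>2 + b\<^sup>2 + c\<^sup>2 + d\<^sup>2 = m" for a b c d :: int
  proof -
    have "a\<^sup>2 \<ge> 0" "b\<^sup>2 \<ge> 0" "c\<^sup>2 \<ge> 0" "d\<^sup>2 \<ge> 0" by simp_all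
    thus ?thesis using that assms by (intro conjI small) linarith+
  qed
  thus ?thesis
    by (auto simp: int_point_list_def int_points_def power2_eq_square)
qed

lemma card_int_points_eq_length:
  "m < 16 \<Longrightarrow> card (int_points m) = length (int_point_list m)"
  using set_int_point_list distinct_card[OF distinct_int_point_list] by metis

lemma length_int_point_list:
  "length (int_point_list 2) = 24" "length (int_point_list 6) = 96" "length (int_point_list 10) = 144"
  by code_simp+

lemma card_int_points:
  "card (int_points 2) = 24" "card (int_points 6) = 96" "card (int_points 10) = 144"
  by (simp_all add: card_int_points_eq_length length_int_point_list)

lemma card_shells: "card (shell 2) = 48" "card (shell 6) = 192" "card (shell 10) = 288"
  using card_shell[of 1] card_shell[of 3] card_shell[of 5] by (simp_all add: card_int_points)

lemma finite_shells: "finite (shell 2)" "finite (shell 6)" "finite (shell 10)"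
  using finite_shell[of 1] finite_shell[of 3] finite_shell[of 5] by simp_all

text \<open>The power of 2 clears the denominator \<open>sqrt 2\<close> of \<open>tau\<close>.\<close>

definition pair_monomial ::
    "nat \<Rightarrow> nat \<Rightarrow> nat \<Rightarrow> nat \<Rightarrow> int \<times> int \<times> int \<times> int \<Rightarrow> int" where
  "pair_monomial p q r s = (\<lambda>(a, b, c, d).
     2 ^ (p + q + r + s) * (a ^ (2 * p) * b ^ (2 * q) * c ^ (2 * r) * d ^ (2 * s)) +
     (a + b) ^ (2 * p) * (a - b) ^ (2 * q) * (c + d) ^ (2 * r) * (c - d) ^ (2 * s))"

definition int_moment :: "int \<Rightarrow> nat \<Rightarrow> nat \<Rightarrow> nat \<Rightarrow> nat \<Rightarrow> int" where
  "int_moment m p q r s = sum_list (map (pair_monomial p q r s) (int_point_list m))"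

text \<open>The bound on m keeps the norm \<open>2 * m\<close> below 16, where the enumeration is
  complete.\<close>

lemma shell_moment_eq_int_moment:
  assumes "m > 0" "m < 8"
  shows "2 ^ (p + q + r + s) * shell_moment (of_int (2 * m)) p q r s = of_int (int_moment (2 * m) p q r s)"
proof -
  have "2 ^ (p + q + r + s) * (even_monomial p q r s (real_vec z) + even_monomial p q r s (tau (real_vec z)))
      = of_int (pair_monomial p q r s z)" for z
  proof -
    obtain a b c d where z: "z = (a, b, c, d)" by (metis prod_cases4)
    show ?thesis
      unfolding z distrib_left even_monomial_tau
      by (simp add: real_vec_def pair_monomial_def even_monomial_def)
  qed
  hence "2 ^ (p + q + r + s) * shell_moment (of_int (2 * m)) p q r s
      = of_int (\<Sum>z\<in>int_points (2 * m). pair_monomial p q r s z)"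
    unfolding shell_moment_def sum_shell[OF assms(1)] sum_distrib_left by simp
  also have "(\<Sum>z\<in>int_points (2 * m). pair_monomial p q r s z) = int_moment (2 * m) p q r s"
    unfolding int_moment_def using assms
    by (simp add: sum_list_distinct_conv_sum_set distinct_int_point_list set_int_point_list)
  finally show ?thesis .
qed

primrec odd_fact_int :: "nat \<Rightarrow> int" where
  "odd_fact_int 0 = 1"
| "odd_fact_int (Suc l) = (2 * int l + 1) * odd_fact_int l"

lemma of_int_odd_fact_int: "of_int (odd_fact_int l) = odd_fact l"
  by (induction l) (simp_all add: odd_fact_Suc)

text \<open>Partitions of k into at most four parts, one for each orbit of exponents under
  permutation.\<close>

definition sorted_exponents :: "nat \<Rightarrow> (nat \<times> nat \<times> nat \<times> nat) list" where
  "sorted_exponents k = [(p, q, r, s). p \<leftarrow> [0..<Suc k], q \<leftarrow> [0..<Suc p], r \<leftarrow> [0..<Suc q],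
     s \<leftarrow> [0..<Suc r], p + q + r + s = k]"

text \<open>Proportionality to the moments of the sphere in executable integer form. Since
  \<open>int_moment\<close> carries the factor 2^(p+q+r+s), so does the constant
  \<open>K\<close>.\<close>

definition moment_identity ::
    "(int \<times> int) list \<Rightarrow> int \<Rightarrow> nat \<Rightarrow> nat \<Rightarrow> nat \<Rightarrow> nat \<Rightarrow> bool" where
  "moment_identity ws K p q r s \<longleftrightarrow>
     (\<Sum>(m, w)\<leftarrow>ws. w * int_moment m p q r s)
     = K * (odd_fact_int p * odd_fact_int q * odd_fact_int r * odd_fact_int s)"

text \<open>
  The weights solve the linear system for the moments; they are the ones for which the contributions
  of the shells to the invariant harmonic polynomials of degree 8 (and 12) cancel.
\<close>

lemma moment_identity_degree_10:
  "list_all (\<lambda>(p, q, r, s). moment_identity [(2, 468), (6, 1)] 3072 p q r s) (sorted_exponents 5)"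
  by code_simp

lemma moment_identity_degree_14:
  "list_all (\<lambda>(p, q, r, s). moment_identity [(2, 101850), (6, 50), (10, 1)] 153600 p q r s)
     (sorted_exponents 7)"
  by code_simp


section \<open>Unions of normalized shells\<close>

lemma sorted_exponents_complete:
  "q \<le> p \<Longrightarrow> r \<le> q \<Longrightarrow> s \<le> r \<Longrightarrow> p + q + r + s = k \<Longrightarrow> (p, q, r, s) \<in> set (sorted_exponents k)"
  by (auto simp: sorted_exponents_def simp del: upt_Suc)

lemma weighted_shell_moment:
  assumes ws: "fst ` set ws \<subseteq> {2, 6, 10}"
    and id: "list_all (\<lambda>(p, q, r, s). moment_identity ws K p q r s) (sorted_exponents k)"
    and k: "p + q + r + s = k"
  shows "(\<Sum>(m, w)\<leftarrow>ws. of_int w * shell_moment (of_int m) p q r s)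
    = of_int K / 2 ^ k * (odd_fact p * odd_fact q * odd_fact r * odd_fact s)"
proof (rule symmetric4_wlog[where k = k and P = "\<lambda>p q r s.
    (\<Sum>(m, w)\<leftarrow>ws. of_int w * shell_moment (of_int m) p q r s)
    = of_int K / 2 ^ k * (odd_fact p * odd_fact q * odd_fact r * odd_fact s)"])
  fix p q r s :: nat
  assume le: "q \<le> p" "r \<le> q" "s \<le> r" and k: "p + q + r + s = k"
  have "moment_identity ws K p q r s"
    using id sorted_exponents_complete[OF le k] by (auto simp: list_all_iff)
  hence "real_of_int (\<Sum>(m, w)\<leftarrow>ws. w * int_moment m p q r s)
      = real_of_int (K * (odd_fact_int p * odd_fact_int q * odd_fact_int r * odd_fact_int s))"
    unfolding moment_identity_def by (rule arg_cong)
  moreover have "real_of_int (\<Sum>(m, w)\<leftarrow>ws. w * int_moment m p q r s)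
      = (\<Sum>(m, w)\<leftarrow>ws. real_of_int (w * int_moment m p q r s))"
    by (induction ws) auto
  ultimately have id': "(\<Sum>(m, w)\<leftarrow>ws. real_of_int (w * int_moment m p q r s))
      = of_int K * (odd_fact p * odd_fact q * odd_fact r * odd_fact s)"
    by (simp only: of_int_mult of_int_odd_fact_int)
  have "2 ^ k * (\<Sum>(m, w)\<leftarrow>ws. of_int w * shell_moment (of_int m) p q r s)
      = (\<Sum>(m, w)\<leftarrow>ws. real_of_int (w * int_moment m p q r s))"
    unfolding sum_list_const_mult[symmetric]
  proof (rule arg_cong[where f = sum_list], rule map_cong[OF refl])
    fix mw assume in_ws: "mw \<in> set ws"
    obtain m w where mw: "mw = (m, w)" by (cases mw)
    have m: "m \<in> {2, 6, 10}" using ws in_ws unfolding mw by force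
    have "2 ^ k * shell_moment (of_int m) p q r s = of_int (int_moment m p q r s)"
      using shell_moment_eq_int_moment[of "m div 2" p q r s] m k by auto
    thus "2 ^ k * (case mw of (m, w) \<Rightarrow> of_int w * shell_moment (of_int m) p q r s)
        = (case mw of (m, w) \<Rightarrow> real_of_int (w * int_moment m p q r s))"
      by (simp add: mw mult_ac)
  qed
  thus "(\<Sum>(m, w)\<leftarrow>ws. of_int w * shell_moment (of_int m) p q r s)
    = of_int K / 2 ^ k * (odd_fact p * odd_fact q * odd_fact r * odd_fact s)"
    unfolding id' by (simp add: field_simps)
qed (use k in \<open>simp_all add: shell_moment_swap mult_ac\<close>)

abbreviation unit_shell :: "real \<Rightarrow> (real^4) set" where
  "unit_shell m \<equiv> (\<lambda>x. (1 / sqrt m) *\<^sub>R x) ` shell m"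

lemma inj_unit_scale: "m > 0 \<Longrightarrow> inj_on (\<lambda>x :: real^4. (1 / sqrt m) *\<^sub>R x) A"
  by (auto simp: inj_on_def)

lemma unit_shell_subset: "m > 0 \<Longrightarrow> unit_shell m \<subseteq> sqsphere 1"
  by (auto simp: shell_def sqsphere_def)

lemma monomial_scaleR: "monomial \<alpha> (c *\<^sub>R x) = c ^ sum \<alpha> UNIV * monomial \<alpha> x"
  by (simp add: monomial_def power_mult_distrib prod.distrib power_sum)

text \<open>Scaling by \<open>1 / sqrt m\<close> divides moments of degree \<open>2 * k\<close> by
  \<open>m ^ k\<close>, and the factor \<open>m ^ k\<close> in the weight restores the moments of
  the unscaled shell. The weight is a sum over all unit shells containing x, so integration splits
  shell by shell.\<close>

lemma cubature_union_unit_shells: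
  fixes J :: "real set" and v :: "real \<Rightarrow> real"
  assumes J: "finite J" "\<And>m. m \<in> J \<Longrightarrow> m > 0" "\<And>m. m \<in> J \<Longrightarrow> finite (shell m)"
    and v: "\<And>m. m \<in> J \<Longrightarrow> v m > 0"
    and total: "(\<Sum>m\<in>J. v m * m ^ k * real (card (shell m))) = 1"
    and even: "\<And>p q r s. p + q + r + s = k \<Longrightarrow> (\<Sum>m\<in>J. v m * shell_moment m p q r s)
      = \<kappa> * (odd_fact p * odd_fact q * odd_fact r * odd_fact s)"
    and t: "t \<le> 2 * k + 1"
  shows "cubature_formula t 1 (\<Union>m\<in>J. unit_shell m)
    (\<lambda>x. \<Sum>m\<in>J. if x \<in> unit_shell m then v m * m ^ k else 0)"
proof -
  let ?X = "\<Union>m\<in>J. unit_shell m"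
  define W where "W x = (\<Sum>m\<in>J. if x \<in> unit_shell m then v m * m ^ k else 0)" for x
  have fin: "finite ?X" using J by blast
  have c: "v m * m ^ k > 0" if "m \<in> J" for m using that v J(2) by simp
  have sum: "(\<Sum>x\<in>?X. W x * G x)
      = (\<Sum>m\<in>J. v m * m ^ k * (\<Sum>x\<in>shell m. G ((1 / sqrt m) *\<^sub>R x)))" for G :: "real^4 \<Rightarrow> real"
  proof -
    have "(\<Sum>x\<in>?X. W x * G x) = (\<Sum>x\<in>?X. \<Sum>m\<in>J. if x \<in> unit_shell m then v m * m ^ k * G x else 0)"
      unfolding W_def sum_distrib_right by (intro sum.cong refl) auto
    also have "\<dots> = (\<Sum>m\<in>J. \<Sum>x\<in>?X. if x \<in> unit_shell m then v m * m ^ k * G x else 0)"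
      by (rule sum.swap)
    also have "\<dots> = (\<Sum>m\<in>J. \<Sum>x\<in>unit_shell m. v m * m ^ k * G x)"
    proof (rule sum.cong[OF refl])
      fix m assume "m \<in> J"
      hence "?X \<inter> unit_shell m = unit_shell m" by blast
      thus "(\<Sum>x\<in>?X. if x \<in> unit_shell m then v m * m ^ k * G x else 0)
          = (\<Sum>x\<in>unit_shell m. v m * m ^ k * G x)"
        using sum.inter_restrict[OF fin, of "\<lambda>x. v m * m ^ k * G x" "unit_shell m"] by simp
    qed
    also have "\<dots> = (\<Sum>m\<in>J. v m * m ^ k * (\<Sum>x\<in>shell m. G ((1 / sqrt m) *\<^sub>R x)))"
      by (intro sum.cong refl) (simp add: sum.reindex[OF inj_unit_scale] J(2) sum_distrib_left)
    finally show ?thesis .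
  qed
  have "cubature_formula t 1 ?X W"
  proof (rule cubature_formula_criterion[OF _ fin _ _ _ t])
    show "?X \<subseteq> sqsphere 1" using unit_shell_subset J(2) by blast
    show "W x > 0" if x: "x \<in> ?X" for x
    proof -
      obtain m where m: "m \<in> J" "x \<in> unit_shell m" using x by blast
      show ?thesis
        unfolding W_def by (rule sum_pos2[OF J(1) m(1)]) (use m c in \<open>auto simp: less_imp_le\<close>)
    qed
    show "sum W ?X = 1" using sum[of "\<lambda>_. 1"] total by simp
    show "(\<Sum>x\<in>?X. W x * monomial \<alpha> x) = 0" if "odd (\<alpha> i)" for \<alpha> i
      unfolding sum monomial_scaleR sum_distrib_left[symmetric] sum_shell_monomial_odd[of \<alpha>, OF that]
      by simp
    show "(\<Sum>x\<in>?X. W x * monomial (\<lambda>i. 2 * \<beta> i) x) = \<kappa> * (\<Prod>i\<in>UNIV. odd_fact (\<beta> i))"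
      if \<beta>: "sum \<beta> UNIV = k" for \<beta>
    proof -
      have "(\<Sum>x\<in>?X. W x * monomial (\<lambda>i. 2 * \<beta> i) x)
          = (\<Sum>m\<in>J. v m * shell_moment m (\<beta> 1) (\<beta> 2) (\<beta> 3) (\<beta> 4))"
        unfolding sum
      proof (rule sum.cong[OF refl])
        fix m assume "m \<in> J"
        hence m: "m > 0" by (rule J(2))
        have "sum (\<lambda>i. 2 * \<beta> i) UNIV = 2 * k" using \<beta> by (simp flip: sum_distrib_left)
        moreover have "m ^ k * (1 / sqrt m) ^ (2 * k) = 1"
          using m by (simp add: power_mult power_divide)
        ultimately show "v m * m ^ k * (\<Sum>x\<in>shell m. monomial (\<lambda>i. 2 * \<beta> i) ((1 / sqrt m) *\<^sub>R x))
            = v m * shell_moment m (\<beta> 1) (\<beta> 2) (\<beta> 3) (\<beta> 4)"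
          unfolding monomial_scaleR sum_distrib_left[symmetric]
          unfolding shell_moment_def monomial_eq_even_monomial
          by (simp add: mult.assoc[symmetric])
      qed
      also have "\<dots> = \<kappa> * (\<Prod>i\<in>UNIV. odd_fact (\<beta> i))"
        using even[of "\<beta> 1" "\<beta> 2" "\<beta> 3" "\<beta> 4"] \<beta> by (simp add: sum_4 prod_4)
      finally show ?thesis .
    qed
  qed simp
  thus ?thesis by (simp only: W_def[abs_def])
qed

section \<open>Disjointness of the unit shells and the sizes of their unions\<close>

lemma shell_coordinate:
  assumes "x \<in> shell (of_int (2 * m))"
  obtains e a :: int where "e = 1 \<or> e = 2" "2 * (x $ i)\<^sup>2 = of_int (e * a\<^sup>2)"
proof -
  from assms consider z where "x = real_vec z" | z where "x = tau (real_vec z)"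
    unfolding shell_eq by blast
  thus ?thesis
  proof cases
    case 1
    obtain a where "real_vec z $ i = of_int a" using real_vec_coordinate by blast
    thus ?thesis using that[of 2 a] 1 by simp
  next
    case 2
    obtain a where "tau (real_vec z) $ i = of_int a / sqrt 2" using tau_real_vec_coordinate by blast
    thus ?thesis using that[of 1 a] 2 by (simp add: power_divide)
  qed
qed

text \<open>Twice the square of a shell coordinate is e a^2 with e = 2 on integer vectors and e = 1
  on their images under \<open>tau\<close>. A common point gives p e a^2 = m f b^2 in each
  coordinate, with e and m f prime to p; so every coordinate vanishes, which contradicts the
  positive norm.\<close>

lemma disjoint_unit_shells:
  fixes m p :: int
  assumes p: "prime p" "p \<noteq> 2" and m: "m > 0" "\<not> p dvd m"
  shows "unit_shell (of_int (2 * m)) \<inter> unit_shell (of_int (2 * p)) = {}"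
proof (rule ccontr)
  assume "unit_shell (of_int (2 * m)) \<inter> unit_shell (of_int (2 * p)) \<noteq> {}"
  then obtain x y z where y: "y \<in> shell (of_int (2 * m))" "x = (1 / sqrt (of_int (2 * m))) *\<^sub>R y"
    and z: "z \<in> shell (of_int (2 * p))" "x = (1 / sqrt (of_int (2 * p))) *\<^sub>R z" by blast
  have p0: "p > 0" using p(1) prime_gt_0_int by blast
  have p2: "\<not> p dvd 2" using p primes_dvd_imp_eq[of p 2] by auto
  have "y $ i = 0" for i
  proof -
    obtain e a where e: "e = 1 \<or> e = 2" "2 * (y $ i)\<^sup>2 = of_int (e * a\<^sup>2)"
      using shell_coordinate[OF y(1)] by metis
    obtain f b where f: "f = 1 \<or> f = 2" "2 * (z $ i)\<^sup>2 = of_int (f * b\<^sup>2)"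
      using shell_coordinate[OF z(1)] by metis
    have yx: "(y $ i)\<^sup>2 = of_int (2 * m) * (x $ i)\<^sup>2"
      using m by (simp add: y(2) power_divide)
    have zx: "(z $ i)\<^sup>2 = of_int (2 * p) * (x $ i)\<^sup>2"
      using p0 by (simp add: z(2) power_divide)
    have "real_of_int (p * e * a\<^sup>2) = of_int p * (2 * (y $ i)\<^sup>2)" unfolding e(2) by simp
    also have "\<dots> = of_int m * (2 * (z $ i)\<^sup>2)" unfolding yx zx by simp
    also have "\<dots> = of_int (m * f * b\<^sup>2)" unfolding f(2) by simp
    finally have eq: "p * e * a\<^sup>2 = m * f * b\<^sup>2" by (simp only: of_int_eq_iff)
    have p1: "\<not> p dvd 1" using p(1) by auto
    have "\<not> p dvd e" using e(1) p1 p2 by auto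
    moreover have "\<not> p dvd m * f" using f(1) p1 p2 m(2) p(1) by (auto simp: prime_dvd_mult_iff)
    ultimately have "a = 0" by (rule prime_times_square_eq_square[OF p(1) _ _ eq])
    thus ?thesis using e(2) by simp
  qed
  hence "y = 0" by (simp add: vec_eq_iff)
  thus False using y(1) m by (simp add: shell_def)
qed

lemma card_unit_shell: "m > 0 \<Longrightarrow> card (unit_shell m) = card (shell m)"
  by (rule card_image[OF inj_unit_scale])

lemma disjoint_unit_shells_2_6_10:
  "unit_shell 2 \<inter> unit_shell 6 = {}" "unit_shell 2 \<inter> unit_shell 10 = {}"
  "unit_shell 6 \<inter> unit_shell 10 = {}"
proof -
  have "prime (3::int)" "prime (5::int)" by simp_all
  thus "unit_shell 2 \<inter> unit_shell 6 = {}" "unit_shell 2 \<inter> unit_shell 10 = {}"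
    "unit_shell 6 \<inter> unit_shell 10 = {}"
    using disjoint_unit_shells[of 3 1] disjoint_unit_shells[of 5 1] disjoint_unit_shells[of 5 3] by simp_all
qed

lemma card_unit_shells_2_6: "card (unit_shell 2 \<union> unit_shell 6) = 240"
  using disjoint_unit_shells_2_6_10(1) finite_shells
  by (simp add: card_Un_disjoint card_unit_shell card_shells)

lemma card_unit_shells_2_6_10: "card (unit_shell 2 \<union> unit_shell 6 \<union> unit_shell 10) = 528"
  using disjoint_unit_shells_2_6_10 finite_shells
  by (simp add: card_Un_disjoint card_unit_shell card_shells Int_Un_distrib2)

lemma cubature_unit_shells_2_6:
  "\<exists>W. cubature_formula 11 1 (unit_shell 2 \<union> unit_shell 6) W"
proof -
  \<comment> \<open>The denominator makes the total weight 1: 468 * 2^5 * 48 + 6^5 * 192 = 2211840.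
    Accordingly 3072 / 2^5 = 96 is 2211840 / (4 * 6 * 8 * 10 * 12), where the divisor is the
    normalization of the degree 10 moments on the 3-sphere.\<close>
  define v :: "real \<Rightarrow> real" where "v m = (if m = 2 then 468 else 1) / 2211840" for m
  have eq: "(\<Sum>m\<in>{2, 6}. v m * shell_moment m p q r s)
      = (3072 / 2 ^ 5 / 2211840) * (odd_fact p * odd_fact q * odd_fact r * odd_fact s)"
    if "p + q + r + s = 5" for p q r s
    using weighted_shell_moment[OF _ moment_identity_degree_10 that] by (simp add: v_def field_simps)
  have "cubature_formula 11 1 (\<Union>m\<in>{2, 6}. unit_shell m)
      (\<lambda>x. \<Sum>m\<in>{2, 6}. if x \<in> unit_shell m then v m * m ^ 5 else 0)"
    by (rule cubature_union_unit_shells[OF _ _ _ _ _ eq]) (auto simp: finite_shells card_shells v_def)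
  thus ?thesis by (intro exI) (simp only: UN_insert UN_empty Un_empty_right)
qed

lemma cubature_unit_shells_2_6_10:
  "\<exists>W. cubature_formula 15 1 (unit_shell 2 \<union> unit_shell 6 \<union> unit_shell 10) W"
proof -
  \<comment> \<open>Again the total weight: 101850 * 2^7 * 48 + 50 * 6^7 * 192 + 10^7 * 288 =
    6193152000.\<close>
  define v :: "real \<Rightarrow> real" where
    "v m = (if m = 2 then 101850 else if m = 6 then 50 else 1) / 6193152000" for m
  have eq: "(\<Sum>m\<in>{2, 6, 10}. v m * shell_moment m p q r s)
      = (153600 / 2 ^ 7 / 6193152000) * (odd_fact p * odd_fact q * odd_fact r * odd_fact s)"
    if "p + q + r + s = 7" for p q r s
    using weighted_shell_moment[OF _ moment_identity_degree_14 that] by (simp add: v_def field_simps)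
  have "cubature_formula 15 1 (\<Union>m\<in>{2, 6, 10}. unit_shell m)
      (\<lambda>x. \<Sum>m\<in>{2, 6, 10}. if x \<in> unit_shell m then v m * m ^ 7 else 0)"
    by (rule cubature_union_unit_shells[OF _ _ _ _ _ eq]) (auto simp: finite_shells card_shells v_def)
  thus ?thesis by (intro exI) (simp only: UN_insert UN_empty Un_empty_right Un_assoc)
qed

theorem mainTheorem1:
  shows "((\<forall>m::nat. m \<ge> 1 \<longrightarrow> spherical_design 7 (2 * real m) (shell (2 * real m))) \<and>
          spherical_design 7 2 (shell 2) \<and> card (shell 2) = 48)
    \<and> (let X = (\<lambda>x. (1 / sqrt 2) *\<^sub>R x) ` shell 2 \<union> (\<lambda>x. (1 / sqrt 6) *\<^sub>R x) ` shell 6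
         in X \<subseteq> sqsphere 1 \<and> (\<exists>W. cubature_formula 11 1 X W) \<and> card X = 240)
    \<and> (let X = (\<lambda>x. (1 / sqrt 2) *\<^sub>R x) ` shell 2 \<union> (\<lambda>x. (1 / sqrt 6) *\<^sub>R x) ` shell 6
               \<union> (\<lambda>x. (1 / sqrt 10) *\<^sub>R x) ` shell 10
         in X \<subseteq> sqsphere 1 \<and> (\<exists>W. cubature_formula 15 1 X W) \<and> card X = 528)"
proof -
  have "unit_shell 2 \<subseteq> sqsphere 1" "unit_shell 6 \<subseteq> sqsphere 1" "unit_shell 10 \<subseteq> sqsphere 1"
    by (rule unit_shell_subset, simp)+
  thus ?thesis
    unfolding Let_def Un_subset_iff
    using spherical_design_shell spherical_design_shell[of 1] card_shells(1)
      cubature_unit_shells_2_6 cubature_unit_shells_2_6_10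
      card_unit_shells_2_6 card_unit_shells_2_6_10
    by simp
qed

end
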